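(* Let $G$ be a finite group, $p$ a prime, and $P$ a Sylow $p$-subgroup of $G$. If $\eta(P)$ is weakly closed in $P$ with respect to $G$, then $P\cap G' = P\cap N_G(\eta(P))'$.
   Context: For a finite $p$-group $P$, a normal subgroup $N$ of $P$ is powerfully embedded in $P$ if $[N,P]\le N^p$ when $p$ is odd, and $[N,P]\le N^4$ when $p=2$ (here $N^{k}$ denotes the subgroup generated by all $k$-th powers of elements of $N$). $\eta(P)$ denotes the largest powerfully embedded subgroup of $P$, i.e. the product of all powerfully embedded subgroups of $P$ (it is itself powerfully embedded and characteristic in $P$). A subgroup $W\le P$ is weakly closed in $P$ with respect to $G$ if for every $g\in G$ with $W^g\le P$ one has $W^g=W$. $X'$ denotes the derived subgroup of $X$. *)

theory Defs
  imports "HOL-Algebra.Algebra"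
begin

definition sylow_subgroup :: "('a, 'b) monoid_scheme \<Rightarrow> nat \<Rightarrow> 'a set \<Rightarrow> bool" where
  "sylow_subgroup G p P \<longleftrightarrow>
     subgroup P G \<and> card P = p ^ multiplicity p (order G)"

definition power_subgroup :: "('a, 'b) monoid_scheme \<Rightarrow> 'a set \<Rightarrow> nat \<Rightarrow> 'a set" where
  "power_subgroup G N k = generate G {x [^]\<^bsub>G\<^esub> k | x. x \<in> N}"

definition commutator_subgroup :: "('a, 'b) monoid_scheme \<Rightarrow> 'a set \<Rightarrow> 'a set \<Rightarrow> 'a set" where
  "commutator_subgroup G N P =
     generate G (\<Union>n \<in> N. \<Union>h \<in> P. {n \<otimes>\<^bsub>G\<^esub> h \<otimes>\<^bsub>G\<^esub> inv\<^bsub>G\<^esub> n \<otimes>\<^bsub>G\<^esub> inv\<^bsub>G\<^esub> h})"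

definition powerfully_embedded :: "('a, 'b) monoid_scheme \<Rightarrow> nat \<Rightarrow> 'a set \<Rightarrow> 'a set \<Rightarrow> bool" where
  "powerfully_embedded G p N P \<longleftrightarrow>
     normal N (G\<lparr>carrier := P\<rparr>) \<and>
     commutator_subgroup G N P \<subseteq> power_subgroup G N (if p = 2 then 4 else p)"

definition eta :: "('a, 'b) monoid_scheme \<Rightarrow> nat \<Rightarrow> 'a set \<Rightarrow> 'a set" where
  "eta G p P = generate G (\<Union> {N. powerfully_embedded G p N P})"

definition weakly_closed :: "('a, 'b) monoid_scheme \<Rightarrow> 'a set \<Rightarrow> 'a set \<Rightarrow> bool" where
  "weakly_closed G W P \<longleftrightarrow>
     (\<forall>g \<in> carrier G. (inv\<^bsub>G\<^esub> g) <#\<^bsub>G\<^esub> W #>\<^bsub>G\<^esub> g \<subseteq> P \<longrightarrow>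
        (inv\<^bsub>G\<^esub> g) <#\<^bsub>G\<^esub> W #>\<^bsub>G\<^esub> g = W)"

end

theory Submission
  imports Defs
begin

text \<open>
  Write \<open>W\<close> for \<open>\<eta>(P)\<close> and \<open>N\<close> for its normalizer. If \<open>P \<inter> G'\<close> were larger than
  \<open>P \<inter> N'\<close>, the transfer \<open>G \<rightarrow> N/N'\<close> restricted to \<open>N\<close> would not be onto modulo \<open>p\<close>, so there would be a
  nontrivial homomorphism \<open>f\<close> from \<open>N\<close> to an abelian group of exponent \<open>p\<close> whose transfer to \<open>G\<close>
  vanishes on \<open>N\<close>. Choose \<open>u \<in> P\<close> of least order with \<open>f u \<noteq> 1\<close>. The transfer of \<open>f\<close> at \<open>u\<close> is a
  product over the right cosets of \<open>N\<close>, and the coset \<open>N\<close> itself contributes \<open>f u\<close>; the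
  contradiction comes from showing that the other cosets contribute nothing.

  Weak closure says that \<open>W\<close> fixes no coset but \<open>N\<close>, and by minimality of \<open>u\<close> only the
  \<open>W\<close>-orbits \<open>B\<close> with \<open>B u = B\<close> matter. Let \<open>R\<close> be the stabilizer of \<open>B\<close> in \<open>P\<close> and \<open>M\<close> a subgroup of
  index \<open>p\<close> in \<open>R\<close> containing a point stabilizer, with orbit \<open>B0\<close>. For \<open>u \<notin> M\<close> the contribution of \<open>B\<close>
  at \<open>u\<close> is that of \<open>B0\<close> at \<open>u^p\<close>, hence trivial. For \<open>u \<in> M\<close> and \<open>w \<in> W - M\<close> it is the product of
  \<open>\<nu> (w^i u w^-i)\<close> over \<open>i < p\<close>, where \<open>\<nu>\<close> is the contribution of \<open>B0\<close>, a homomorphism on \<open>M\<close>.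
  Since \<open>[W, P] \<le> W^p\<close> (\<open>W^4\<close> for \<open>p = 2\<close>), the factors form a geometric progression whose product is
  trivial.
\<close>

section \<open>Fixed points of \<open>p\<close>-groups\<close>

text \<open>Orbit sizes divide the group order, so each orbit is a single fixed point or has size
  divisible by \<open>p\<close>. Summing the sizes over all orbits leaves only the fixed points
  modulo \<open>p\<close>.\<close>

lemma (in group_action) fixed_points_cong:
  assumes "finite E" "Factorial_Ring.prime (p::nat)" "order G = p ^ n"
  shows "card E mod p = card {x \<in> E. \<forall>g \<in> carrier G. (\<phi> g) x = x} mod p"
proof -
  let ?F = "{x \<in> E. \<forall>g \<in> carrier G. (\<phi> g) x = x}"
  let ?Os = "orbits G E \<phi>"
  have part: "partition E ?Os" by (rule orbit_partition)
  have sub: "Orb \<subseteq> E" if "Orb \<in> ?Os" for Orb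
    using that partition.partition_coverture[OF part] by blast
  have fin: "finite ?Os"
    by (rule finite_subset[of _ "Pow E"]) (use sub assms(1) in auto)
  have F: "{x} \<in> ?Os" if "x \<in> ?F" for x
  proof -
    have "orbit G \<phi> x = {x}"
      using that orbit_refl[of x] unfolding orbit_def by blast
    thus ?thesis using that unfolding orbits_def by blast
  qed
  have Orb: "(\<exists>x \<in> ?F. Orb = {x}) \<or> p dvd card Orb" if "Orb \<in> ?Os" for Orb
  proof -
    obtain x where x: "x \<in> E" "Orb = orbit G \<phi> x" using \<open>Orb \<in> ?Os\<close> unfolding orbits_def by blast
    have "card Orb dvd p ^ n"
      using orbit_stabilizer_theorem[OF x(1)] assms(3) x(2) by (metis dvd_triv_left)
    then obtain i where i: "card Orb = p ^ i" using divides_primepow_nat[OF assms(2)] by blast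
    show ?thesis
    proof (cases i)
      case 0
      then obtain y where y: "Orb = {y}" using i card_1_singletonE by auto
      hence "Orb = {x}" using orbit_refl[OF x(1)] x(2) by auto
      moreover have "x \<in> ?F" using \<open>Orb = {x}\<close> x unfolding orbit_def by blast
      ultimately show ?thesis by blast
    qed (use i in simp)
  qed
  have "card E = (\<Sum>Orb\<in>?Os. card Orb)"
    using partition.disjoint_sum[OF part assms(1), of "\<lambda>_. 1 :: nat"] by simp
  also have "\<dots> = (\<Sum>Orb\<in>(\<lambda>x. {x}) ` ?F. card Orb) + (\<Sum>Orb\<in>?Os - (\<lambda>x. {x}) ` ?F. card Orb)"
    by (subst sum.subset_diff[of "(\<lambda>x. {x}) ` ?F"]) (use F fin in auto)
  also have "(\<Sum>Orb\<in>(\<lambda>x. {x}) ` ?F. card Orb) = card ?F"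
    by (subst sum.reindex) (auto simp: inj_on_def)
  finally have "card E = card ?F + (\<Sum>Orb\<in>?Os - (\<lambda>x. {x}) ` ?F. card Orb)" .
  moreover have "p dvd (\<Sum>Orb\<in>?Os - (\<lambda>x. {x}) ` ?F. card Orb)"
    by (rule dvd_sum) (use Orb in blast)
  ultimately show ?thesis
    by (auto elim!: dvdE)
qed

context group
begin

lemma inv_cancel:
  assumes "x \<in> carrier G" "y \<in> carrier G"
  shows "inv x \<otimes> (x \<otimes> y) = y" "x \<otimes> (inv x \<otimes> y) = y"
  using assms by (simp_all flip: m_assoc)

lemma rcosets_fixed_points_cong:
  assumes "finite (carrier G)" "Factorial_Ring.prime (p::nat)"
    and U: "subgroup U G" "card U = p ^ n" and H: "subgroup H G"
  shows "card (rcosets H) mod p = card {C \<in> rcosets H. \<forall>u \<in> U. C #> u = C} mod p"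
proof -
  \<comment> \<open>The inverse turns right multiplication into the left action that
    \<open>group_action\<close> expects. Since \<open>U\<close> is closed under inverses, the fixed
    cosets are the same.\<close>
  let ?\<phi> = "\<lambda>u. \<lambda>C \<in> rcosets H. C #> inv u"
  have UG: "u \<in> carrier G" if "u \<in> U" for u using subgroup.subset[OF U(1)] that by blast
  have CG: "C \<subseteq> carrier G" if "C \<in> rcosets H" for C
    using that subgroup.rcosets_carrier[OF H is_group] by blast
  have cl: "C #> g \<in> rcosets H" if "C \<in> rcosets H" "g \<in> carrier G" for C g
    using that subgroup.subset[OF H] unfolding RCOSETS_def by (auto simp: coset_mult_assoc)
  have grp: "group (G\<lparr>carrier := U\<rparr>)" by (rule subgroup.subgroup_is_group[OF U(1) is_group])
  have bij: "bij_betw (\<lambda>C. C #> inv u) (rcosets H) (rcosets H)" if "u \<in> U" for u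
    by (rule bij_betw_byWitness[where f' = "\<lambda>C. C #> u"])
      (use that UG CG cl in \<open>auto simp: coset_mult_assoc\<close>)
  interpret A: group_action "G\<lparr>carrier := U\<rparr>" "rcosets H" ?\<phi>
    unfolding group_action_def group_hom_def group_hom_axioms_def
  proof (intro conjI grp group_BijGroup homI)
    fix u assume "u \<in> carrier (G\<lparr>carrier := U\<rparr>)"
    thus "?\<phi> u \<in> carrier (BijGroup (rcosets H))"
      using bij by (auto simp: BijGroup_def Bij_def)
  next
    fix u v assume "u \<in> carrier (G\<lparr>carrier := U\<rparr>)" "v \<in> carrier (G\<lparr>carrier := U\<rparr>)"
    hence uv: "u \<in> U" "v \<in> U" by auto
    thus "?\<phi> (u \<otimes>\<^bsub>G\<lparr>carrier := U\<rparr>\<^esub> v) = ?\<phi> u \<otimes>\<^bsub>BijGroup (rcosets H)\<^esub> ?\<phi> v"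
      using bij UG CG cl by (auto simp: BijGroup_def Bij_def compose_def fun_eq_iff
        coset_mult_assoc inv_mult_group)
  qed
  have "{C \<in> rcosets H. \<forall>g \<in> carrier (G\<lparr>carrier := U\<rparr>). ?\<phi> g C = C} =
        {C \<in> rcosets H. \<forall>u \<in> U. C #> u = C}"
  proof (intro Collect_cong conj_cong refl)
    fix C assume C: "C \<in> rcosets H"
    have "(\<forall>u\<in>U. C #> inv u = C) \<longleftrightarrow> (\<forall>u\<in>U. C #> u = C)"
      using subgroup.m_inv_closed[OF U(1)] UG by (metis inv_inv)
    thus "(\<forall>g \<in> carrier (G\<lparr>carrier := U\<rparr>). ?\<phi> g C = C) = (\<forall>u\<in>U. C #> u = C)" using C by simp
  qed
  moreover have "finite (rcosets H)"
    using assms(1) rcosets_part_G[OF H] finite_UnionD by metis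
  ultimately show ?thesis
    using A.fixed_points_cong[of p n] assms(2) U(2) by (simp add: order_def)
qed

lemma rcos_fixed_iff:
  assumes "subgroup H G" "g \<in> carrier G" "u \<in> carrier G"
  shows "(H #> g) #> u = H #> g \<longleftrightarrow> g \<otimes> u \<otimes> inv g \<in> H"
proof -
  have HG: "H \<subseteq> carrier G" by (rule subgroup.subset[OF assms(1)])
  have "(H #> g) #> u = H #> (g \<otimes> u)" using assms HG by (simp add: coset_mult_assoc)
  also have "\<dots> = H #> g \<longleftrightarrow> H #> (g \<otimes> u \<otimes> inv g) = H"
    using assms HG coset_mult_inv1 coset_mult_inv2 by (metis inv_closed m_closed)
  also have "\<dots> \<longleftrightarrow> g \<otimes> u \<otimes> inv g \<in> H"
    using assms HG coset_join1 coset_join2 by (metis inv_closed m_closed)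
  finally show ?thesis .
qed

text \<open>This is the conjugacy part of Sylow's theorem. The number of cosets fixed by
  \<open>U\<close> is congruent to the index of \<open>H\<close>, hence nonzero modulo
  \<open>p\<close>, and a fixed coset \<open>H #> g\<close> says that \<open>g\<close> conjugates
  \<open>U\<close> into \<open>H\<close>.\<close>

lemma p_subgroup_conj_into_index_coprime:
  assumes "finite (carrier G)" "Factorial_Ring.prime (p::nat)"
    and U: "subgroup U G" "card U = p ^ n" and H: "subgroup H G" "\<not> p dvd card (rcosets H)"
  obtains g where "g \<in> carrier G" "\<And>u. u \<in> U \<Longrightarrow> g \<otimes> u \<otimes> inv g \<in> H"
proof -
  let ?F = "{C \<in> rcosets H. \<forall>u \<in> U. C #> u = C}"
  have "card (rcosets H) mod p = card ?F mod p"
    using rcosets_fixed_points_cong assms by blast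
  hence "card ?F \<noteq> 0" using H(2) by (metis dvd_eq_mod_eq_0 mod_0)
  hence "?F \<noteq> {}" by force
  then obtain C where "C \<in> rcosets H" "\<forall>u \<in> U. C #> u = C" by blast
  moreover then obtain g where g: "g \<in> carrier G" "C = H #> g" unfolding RCOSETS_def by blast
  ultimately have "g \<otimes> u \<otimes> inv g \<in> H" if "u \<in> U" for u
    using rcos_fixed_iff[OF H(1)] that subgroup.subset[OF U(1)] by blast
  thus ?thesis using that g(1) by blast
qed

text \<open>Let \<open>M\<close> act on its own cosets. It fixes the coset \<open>M\<close>, and the
  number of fixed cosets is divisible by \<open>p\<close>, so it fixes another one,
  \<open>M #> g\<close>. Then \<open>g\<close> lies outside \<open>M\<close> and normalizes it, so
  by maximality the normalizer is everything.\<close>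

lemma maximal_subgroup_of_p_group_normal:
  assumes "finite (carrier G)" "Factorial_Ring.prime (p::nat)" "order G = p ^ n"
    and M: "subgroup M G" "M \<noteq> carrier G"
    and max: "\<And>K. \<lbrakk>subgroup K G; M \<subset> K\<rbrakk> \<Longrightarrow> K = carrier G"
  shows "M \<lhd> G"
proof -
  have MG: "M \<subseteq> carrier G" by (rule subgroup.subset[OF M(1)])
  let ?F = "{C \<in> rcosets M. \<forall>u \<in> M. C #> u = C}"
  have fin: "finite (rcosets M)"
    using assms(1) rcosets_part_G[OF M(1)] finite_UnionD by metis
  have lag: "card (rcosets M) * card M = p ^ n" using lagrange[OF M(1)] assms(3) by simp
  then obtain i where i: "card M = p ^ i" using divides_primepow_nat[OF assms(2)] by (metis dvd_triv_right)
  have "card (rcosets M) \<noteq> 1"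
    using lag assms(1,3) M(2) MG card_subset_eq unfolding order_def by (metis mult_1)
  then have "p dvd card (rcosets M)"
    using lag divides_primepow_nat[OF assms(2)]
    by (metis dvd_power dvd_triv_left gr0I power_0)
  moreover have "card (rcosets M) mod p = card ?F mod p"
    using rcosets_fixed_points_cong[OF assms(1,2) M(1) i M(1)] .
  ultimately have dv: "p dvd card ?F" by (simp add: dvd_eq_mod_eq_0)
  have "M \<in> ?F" 
    by (simp add: MG subgroup.rcos_const[OF M(1) is_group] subgroup.subgroup_in_rcosets[OF M(1) is_group])
  moreover have "?F \<noteq> {M}" using dv assms(2) by auto
  ultimately obtain C where C: "C \<in> ?F" "C \<noteq> M" by blast
  then obtain g where g: "g \<in> carrier G" "C = M #> g" unfolding RCOSETS_def by blast
  have gM: "g \<notin> M" using C g subgroup.rcos_const[OF M(1) is_group] by blast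
  have gm: "g \<otimes> m \<otimes> inv g \<in> M" if "m \<in> M" for m
    using rcos_fixed_iff[OF M(1) g(1)] C(1) g(2) that MG by blast
  \<comment> \<open>This is the normalizer of \<open>M\<close>. Written with an equivalence, it is
    visibly closed under inverses.\<close>
  let ?K = "{x \<in> carrier G. \<forall>m \<in> carrier G. m \<in> M \<longleftrightarrow> x \<otimes> m \<otimes> inv x \<in> M}"
  have "subgroup ?K G"
  proof (rule subgroupI)
    fix x assume x: "x \<in> ?K"
    hence xG: "x \<in> carrier G" by blast
    have "m \<in> M \<longleftrightarrow> inv x \<otimes> m \<otimes> inv (inv x) \<in> M" if m: "m \<in> carrier G" for m
    proof -
      have "x \<otimes> (inv x \<otimes> m \<otimes> x) \<otimes> inv x = m" using xG m by (simp add: m_assoc inv_cancel)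
      moreover have "inv x \<otimes> m \<otimes> x \<in> M \<longleftrightarrow> x \<otimes> (inv x \<otimes> m \<otimes> x) \<otimes> inv x \<in> M"
        using x m by blast
      ultimately show ?thesis using x by simp
    qed
    thus "inv x \<in> ?K" using x by blast
  next
    fix x y assume xy: "x \<in> ?K" "y \<in> ?K"
    have "x \<otimes> y \<otimes> m \<otimes> inv (x \<otimes> y) = x \<otimes> (y \<otimes> m \<otimes> inv y) \<otimes> inv x" if "m \<in> carrier G" for m
      using xy that by (simp add: m_assoc inv_mult_group)
    thus "x \<otimes> y \<in> ?K" using xy by auto
  qed (use M(1) subgroup.one_closed in auto)
  moreover have "M \<subset> ?K"
  proof -
    have "g \<in> ?K"
    proof -
      have inj: "inj_on (\<lambda>m. g \<otimes> m \<otimes> inv g) (carrier G)"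
        using g(1) by (auto intro!: inj_onI)
      \<comment> \<open>An injective map of the finite set \<open>M\<close> into itself is onto,
        which gives the reverse direction of the equivalence in \<open>?K\<close>.\<close>
      have "(\<lambda>m. g \<otimes> m \<otimes> inv g) ` M = M"
      proof (rule endo_inj_surj)
        show "finite M" using finite_subset[OF MG assms(1)] .
        show "(\<lambda>m. g \<otimes> m \<otimes> inv g) ` M \<subseteq> M" using gm by blast
        show "inj_on (\<lambda>m. g \<otimes> m \<otimes> inv g) M" using inj_on_subset[OF inj MG] .
      qed
      hence "m \<in> M" if m: "m \<in> carrier G" "g \<otimes> m \<otimes> inv g \<in> M" for m
      proof -
        obtain m' where m': "m' \<in> M" "g \<otimes> m \<otimes> inv g = g \<otimes> m' \<otimes> inv g"
          using m(2) \<open>(\<lambda>m. g \<otimes> m \<otimes> inv g) ` M = M\<close> by (metis (no_types, lifting) imageE)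
        show ?thesis using inj_onD[OF inj m'(2) m(1)] m'(1) MG by blast
      qed
      thus ?thesis using g(1) gm by blast
    qed
    moreover have "m \<in> ?K" if m: "m \<in> M" for m
    proof -
      have mG: "m \<in> carrier G" using m MG by blast
      have "m' \<in> M \<longleftrightarrow> m \<otimes> m' \<otimes> inv m \<in> M" if m': "m' \<in> carrier G" for m'
      proof
        assume "m' \<in> M"
        thus "m \<otimes> m' \<otimes> inv m \<in> M"
          by (intro subgroup.m_closed[OF M(1)] subgroup.m_inv_closed[OF M(1)] m)
      next
        assume "m \<otimes> m' \<otimes> inv m \<in> M"
        from subgroup.m_closed[OF M(1) subgroup.m_closed[OF M(1) subgroup.m_inv_closed[OF M(1) m] this] m]
        have "inv m \<otimes> (m \<otimes> m' \<otimes> inv m) \<otimes> m \<in> M" .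
        moreover have "inv m \<otimes> (m \<otimes> m' \<otimes> inv m) \<otimes> m = m'"
          using mG m' by (simp add: m_assoc inv_cancel)
        ultimately show "m' \<in> M" by simp
      qed
      thus ?thesis using mG by blast
    qed
    ultimately show ?thesis using gM by blast
  qed
  ultimately have "?K = carrier G" by (rule max)
  thus ?thesis using M(1) unfolding normal_inv_iff using MG by blast
qed

text \<open>A maximal proper subgroup \<open>M\<close> above \<open>H\<close> is normal. Its
  quotient is a nontrivial \<open>p\<close>-group and so has a subgroup of order \<open>p\<close>.
  By maximality the preimage of that subgroup is the whole group, so the quotient itself has order
  \<open>p\<close>.\<close>

lemma p_group_index_p_subgroup:
  assumes "finite (carrier G)" "Factorial_Ring.prime (p::nat)" "order G = p ^ n"
    and H: "subgroup H G" "H \<noteq> carrier G"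
  obtains M where "M \<lhd> G" "H \<subseteq> M" "card (rcosets M) = p"
proof -
  define S where "S = {K. subgroup K G \<and> H \<subseteq> K \<and> K \<noteq> carrier G}"
  have "S \<subseteq> Pow (carrier G)" using subgroup.subset unfolding S_def by fast
  hence "finite S" by (rule finite_subset) (use assms(1) in simp)
  moreover have "H \<in> S" using H by (simp add: S_def)
  hence "S \<noteq> {}" by (metis empty_iff)
  ultimately have "\<exists>M\<in>S. \<forall>K\<in>S. M \<subseteq> K \<longrightarrow> M = K" by (rule finite_has_maximal)
  then obtain M where M: "M \<in> S" "\<And>K. K \<in> S \<Longrightarrow> M \<subseteq> K \<Longrightarrow> M = K" by blast
  have sM: "subgroup M G" "M \<noteq> carrier G" using M(1) by (auto simp: S_def)
  have max: "K = carrier G" if "subgroup K G" "M \<subset> K" for K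
    using M(1) M(2)[of K] that unfolding S_def by blast
  have nM: "M \<lhd> G" using maximal_subgroup_of_p_group_normal[OF assms(1-3) sM max] .
  interpret M: normal M G by (rule nM)
  interpret Q: group "G Mod M" by (rule M.factorgroup_is_group)
  have lag: "card (rcosets M) * card M = p ^ n" using lagrange[OF sM(1)] assms(3) by simp
  then obtain i where i: "card (rcosets M) = p ^ i"
    using divides_primepow_nat[OF assms(2)] by (metis dvd_triv_left)
  have "card (rcosets M) \<noteq> 1"
    using lag assms(1,3) sM(2) M.subset card_subset_eq unfolding order_def by (metis mult_1)
  hence "i > 0" using i by (metis gr0I power_0)
  hence "order (G Mod M) = p ^ 1 * p ^ (i - 1)"
    using i by (simp add: order_def FactGroup_def flip: power_Suc)
  moreover have finQ: "finite (carrier (G Mod M))"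
    using assms(1) rcosets_part_G[OF sM(1)] finite_UnionD by (metis FactGroup_def partial_object.select_convs(1))
  ultimately obtain L where L: "subgroup L (G Mod M)" "card L = p"
    using sylow_thm[OF assms(2) Q.is_group, of 1] by (metis power_one_right)
  let ?K = "{x \<in> carrier G. M #> x \<in> L}"
  have "subgroup ?K G"
  proof (rule subgroupI)
    fix x assume x: "x \<in> ?K"
    hence "inv\<^bsub>G Mod M\<^esub> (M #> x) \<in> L" using L(1) subgroup.m_inv_closed by fastforce
    thus "inv x \<in> ?K" using x by (simp add: M.inv_FactGroup M.rcos_inv carrier_FactGroup)
  next
    fix x y assume xy: "x \<in> ?K" "y \<in> ?K"
    hence "(M #> x) <#> (M #> y) \<in> L" using L(1) subgroup.m_closed by fastforce
    thus "x \<otimes> y \<in> ?K" using xy by (simp add: M.rcos_sum)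
  qed (use subgroup.one_closed[OF L(1)] M.subset in auto)
  moreover have LK: "L = (\<lambda>x. M #> x) ` ?K"
    using subgroup.subset[OF L(1)] unfolding carrier_FactGroup by blast
  moreover have "M \<subset> ?K"
  proof -
    have "M \<subseteq> ?K" using subgroup.one_closed[OF L(1)] M.subset M.rcos_const[OF is_group] by auto
    moreover have "M \<noteq> ?K"
    proof
      assume "M = ?K"
      hence "L \<subseteq> {M}" using LK M.rcos_const[OF is_group] by blast
      hence "card L \<le> 1" using card_mono[of "{M}" L] by simp
      thus False using L(2) prime_gt_1_nat[OF assms(2)] by simp
    qed
    ultimately show ?thesis by blast
  qed
  ultimately have "?K = carrier G" by (simp add: max)
  hence "L = rcosets M" using LK by (simp add: carrier_FactGroup[symmetric] FactGroup_def)
  thus ?thesis using that[OF nM] M(1) L(2) unfolding S_def by simp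
qed

end

section \<open>Cocycles of a group action\<close>

locale cocycle = group G + A: comm_group A
  for G :: "('a, 'b) monoid_scheme" (structure) and A :: "('c, 'd) monoid_scheme" +
  fixes \<Omega> :: "'x set" and act :: "'x \<Rightarrow> 'a \<Rightarrow> 'x" and c :: "'x \<Rightarrow> 'a \<Rightarrow> 'c"
  \<comment> \<open>\<open>act\<close> is a right action; \<open>c\<close> is a crossed homomorphism into the functions \<open>\<Omega> \<rightarrow> A\<close>\<close>
  assumes act_closed: "\<lbrakk>x \<in> \<Omega>; g \<in> carrier G\<rbrakk> \<Longrightarrow> act x g \<in> \<Omega>"
    and act_one: "x \<in> \<Omega> \<Longrightarrow> act x \<one> = x"
    and act_mult: "\<lbrakk>x \<in> \<Omega>; g \<in> carrier G; h \<in> carrier G\<rbrakk> \<Longrightarrow> act x (g \<otimes> h) = act (act x g) h"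
    and c_closed: "\<lbrakk>x \<in> \<Omega>; g \<in> carrier G\<rbrakk> \<Longrightarrow> c x g \<in> carrier A"
    and c_mult: "\<lbrakk>x \<in> \<Omega>; g \<in> carrier G; h \<in> carrier G\<rbrakk>
      \<Longrightarrow> c x (g \<otimes> h) = c x g \<otimes>\<^bsub>A\<^esub> c (act x g) h"
begin

lemma act_inv:
  assumes "x \<in> \<Omega>" "g \<in> carrier G"
  shows "act (act x g) (inv g) = x" "act (act x (inv g)) g = x"
  using assms by (simp_all add: act_one flip: act_mult)

lemma inj_on_act:
  assumes "g \<in> carrier G" shows "inj_on (\<lambda>x. act x g) \<Omega>"
  by (rule inj_on_inverseI[where g = "\<lambda>x. act x (inv g)"]) (use assms act_inv in simp)

lemma act_pow_fixed:
  assumes "x \<in> \<Omega>" "g \<in> carrier G" "act x g = x"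
  shows "act x (g [^] (k::nat)) = x"
  using assms by (induction k) (simp_all add: act_one act_mult)

lemma c_one:
  assumes "x \<in> \<Omega>" shows "c x \<one> = \<one>\<^bsub>A\<^esub>"
  using c_mult[of x \<one> \<one>] c_closed[of x \<one>] assms by (simp add: act_one A.l_cancel_one')

lemma c_pow:
  assumes "x \<in> \<Omega>" "g \<in> carrier G"
  shows "c x (g [^] (k::nat)) = finprod A (\<lambda>i. c (act x (g [^] i)) g) {..<k}"
proof (induction k)
  case 0
  thus ?case using assms by (simp add: c_one)
next
  case (Suc k)
  have "(\<lambda>i. c (act x (g [^] i)) g) \<in> {..<Suc k} \<rightarrow> carrier A"
    using assms by (auto intro: c_closed act_closed)
  thus ?case using assms Suc
    by (simp add: c_mult lessThan_Suc A.m_comm c_closed act_closed)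
qed

lemma c_pow_fixed:
  assumes "x \<in> \<Omega>" "g \<in> carrier G" "act x g = x"
  shows "c x (g [^] (k::nat)) = c x g [^]\<^bsub>A\<^esub> k"
  using assms by (induction k) (simp_all add: c_one c_mult act_pow_fixed)

text \<open>Expand the value at \<open>h \<otimes> u\<close>, which is also
  \<open>(h \<otimes> u \<otimes> inv h) \<otimes> h\<close>, in two ways. The factor
  \<open>c x h\<close> occurs in both and cancels because \<open>A\<close> is abelian.\<close>

lemma c_conj:
  assumes "x \<in> \<Omega>" "h \<in> carrier G" "u \<in> carrier G" "act x (h \<otimes> u \<otimes> inv h) = x"
  shows "c (act x h) u = c x (h \<otimes> u \<otimes> inv h)"
proof -
  have "c x h \<otimes>\<^bsub>A\<^esub> c (act x h) u = c x (h \<otimes> u)" using assms by (simp add: c_mult)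
  also have "h \<otimes> u = (h \<otimes> u \<otimes> inv h) \<otimes> h" using assms by (simp add: m_assoc)
  also have "c x \<dots> = c x (h \<otimes> u \<otimes> inv h) \<otimes>\<^bsub>A\<^esub> c x h"
    using assms by (simp add: c_mult)
  also have "\<dots> = c x h \<otimes>\<^bsub>A\<^esub> c x (h \<otimes> u \<otimes> inv h)"
    using assms by (intro A.m_comm c_closed) auto
  finally show ?thesis using assms by (simp add: c_closed act_closed)
qed

text \<open>This is the evaluation of a transfer by cycles: by \<open>c_pow\<close> a cycle of
  length \<open>k\<close> through \<open>x\<close> contributes \<open>c x (g [^] k)\<close>, where
  \<open>g [^] k\<close> fixes \<open>x\<close>. The induction removes one cycle at a time.\<close>

lemma cycles_trivial:
  assumes "finite (carrier G)" "g \<in> carrier G"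
    and "finite S" "S \<subseteq> \<Omega>" "\<And>x. x \<in> S \<Longrightarrow> act x g \<in> S"
    and "\<And>x k. \<lbrakk>x \<in> S; act x (g [^] (k::nat)) = x\<rbrakk> \<Longrightarrow> c x (g [^] k) = \<one>\<^bsub>A\<^esub>"
  shows "finprod A (\<lambda>x. c x g) S = \<one>\<^bsub>A\<^esub>"
  using assms(3-6)
proof (induction S rule: finite_psubset_induct)
  case (psubset S)
  have cG: "(\<lambda>x. c x g) \<in> S' \<rightarrow> carrier A" if "S' \<subseteq> S" for S'
    using that psubset.prems(1) assms(2) by (auto intro: c_closed)
  show ?case
  proof (cases "S = {}")
    case False
    then obtain x where x: "x \<in> S" by blast
    hence xO: "x \<in> \<Omega>" using psubset.prems(1) by blast
    let ?P = "\<lambda>k::nat. k > 0 \<and> act x (g [^] k) = x"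
    have "?P (order G)"
      using assms(1,2) xO by (simp add: pow_order_eq_1 act_one order_gt_0_iff_finite)
    \<comment> \<open>The least positive exponent fixing \<open>x\<close> is the length of its
      cycle; leastness makes the points of the cycle distinct.\<close>
    define k where "k = (LEAST k. ?P k)"
    have k: "?P k" unfolding k_def by (rule LeastI) fact
    have least: "\<not> ?P i" if "i < k" for i using not_less_Least[of i ?P] that unfolding k_def by blast
    let ?f = "\<lambda>i::nat. act x (g [^] i)"
    let ?O = "?f ` {..<k}"
    have Suc_f: "act (?f i) g = ?f (Suc i)" for i
      using xO assms(2) by (simp add: act_mult)
    have OS: "?O \<subseteq> S"
    proof -
      have "?f i \<in> S" for i
      proof (induction i)
        case (Suc i)
        thus ?case using psubset.prems(2) Suc_f[of i] by metis
      qed (use x xO in \<open>simp add: act_one\<close>)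
      thus ?thesis by blast
    qed
    have "inj_on ?f {..<k}"
    proof (rule linorder_inj_onI)
      fix i j assume ij: "i < j" "i \<in> {..<k}" "j \<in> {..<k}"
      show "?f i \<noteq> ?f j"
      proof
        assume "?f i = ?f j"
        also have "?f j = act (?f (j - i)) (g [^] i)"
          using ij xO assms(2) by (simp add: nat_pow_mult flip: act_mult)
        finally have "x = ?f (j - i)"
          using inj_onD[OF inj_on_act[of "g [^] i"]] xO assms(2) by (simp add: act_closed)
        moreover have "j - i < k" "0 < j - i" using ij by auto
        ultimately show False using least[of "j - i"] by simp
      qed
    qed auto
    moreover have "?f ` {..<k} \<subseteq> S" by (rule OS)
    ultimately have "finprod A (\<lambda>x. c x g) ?O = finprod A (\<lambda>i. c (?f i) g) {..<k}"
      by (intro A.finprod_reindex cG)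
    also have "\<dots> = c x (g [^] k)" using xO assms(2) by (simp add: c_pow)
    also have "\<dots> = \<one>\<^bsub>A\<^esub>" using psubset.prems(3) x k by blast
    finally have TO: "finprod A (\<lambda>x. c x g) ?O = \<one>\<^bsub>A\<^esub>" .
    \<comment> \<open>As \<open>g\<close> permutes the cycle and acts injectively, it also preserves
      the complement of the cycle, to which the induction hypothesis then applies.\<close>
    have gO: "(\<lambda>x. act x g) ` ?O = ?O"
    proof (rule endo_inj_surj)
      have "?f (Suc i) \<in> ?O" if "i < k" for i
      proof (cases "Suc i < k")
        case False
        hence "Suc i = k" using that by simp
        hence "?f (Suc i) = ?f 0" using k xO by (simp add: act_one del: nat_pow_Suc)
        thus ?thesis using k by blast
      qed blast
      thus "(\<lambda>x. act x g) ` ?O \<subseteq> ?O" by (auto simp: Suc_f simp del: nat_pow_Suc)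
      show "inj_on (\<lambda>x. act x g) ?O"
        using inj_on_subset[OF inj_on_act[OF assms(2)]] OS psubset.prems(1) by blast
    qed simp
    have T: "finprod A (\<lambda>x. c x g) (S - ?O) = \<one>\<^bsub>A\<^esub>"
    proof (rule psubset.IH)
      have "x \<in> ?O" using k xO by (intro image_eqI[of _ _ 0]) (auto simp: act_one)
      thus "S - ?O \<subset> S" using x by blast
      show "act y g \<in> S - ?O" if y: "y \<in> S - ?O" for y
      proof
        show "act y g \<in> S" using y psubset.prems(2) by blast
        show "act y g \<notin> ?O"
        proof
          assume "act y g \<in> ?O"
          then obtain z where "z \<in> ?O" "act y g = act z g" using gO by (metis (no_types, lifting) imageE)
          hence "y = z"
            using inj_onD[OF inj_on_act[OF assms(2)]] y OS psubset.prems(1) by blast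
          thus False using y \<open>z \<in> ?O\<close> by blast
        qed
      qed
    qed (use psubset.prems in auto)
    have "finprod A (\<lambda>x. c x g) (?O \<union> (S - ?O)) = \<one>\<^bsub>A\<^esub>"
      by (subst A.finprod_Un_disjoint) (use TO T psubset.hyps OS cG in auto)
    thus ?thesis using OS by (simp add: Un_absorb1 Un_Diff_cancel)
  qed simp
qed

section \<open>Cocycles on blocks of points\<close>

definition set_act :: "'x set \<Rightarrow> 'a \<Rightarrow> 'x set" where
  "set_act B g = (\<lambda>x. act x g) ` B"

definition set_cocycle :: "'x set \<Rightarrow> 'a \<Rightarrow> 'c" where
  "set_cocycle B g = finprod A (\<lambda>x. c x g) B"

text \<open>Blocks become points of a new cocycle, so that conjugation, powers and cycle evaluation
  apply to them unchanged. Multiplicativity uses that \<open>g\<close> maps \<open>B\<close>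
  bijectively onto its translate.\<close>

lemma cocycle_sets: "cocycle G A {B. B \<subseteq> \<Omega> \<and> finite B} set_act set_cocycle"
proof
  fix B g assume B: "B \<in> {B. B \<subseteq> \<Omega> \<and> finite B}" and g: "g \<in> carrier G"
  hence c: "(\<lambda>x. c x g) \<in> B \<rightarrow> carrier A" by (auto intro: c_closed)
  show "set_act B g \<in> {B. B \<subseteq> \<Omega> \<and> finite B}"
    using B g act_closed unfolding set_act_def by blast
  show "set_cocycle B g \<in> carrier A"
    unfolding set_cocycle_def by (rule A.finprod_closed[OF c])
  fix h assume h: "h \<in> carrier G"
  show "set_act B (g \<otimes> h) = set_act (set_act B g) h"
    using B g h act_mult unfolding set_act_def image_image by (intro image_cong) auto
  have "finprod A (\<lambda>x. c x h) ((\<lambda>x. act x g) ` B) = finprod A (\<lambda>x. c (act x g) h) B"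
    using B g h by (intro A.finprod_reindex inj_on_subset[OF inj_on_act])
      (auto intro: c_closed act_closed)
  moreover have "finprod A (\<lambda>x. c x (g \<otimes> h)) B = finprod A (\<lambda>x. c x g \<otimes>\<^bsub>A\<^esub> c (act x g) h) B"
    using B g h by (intro A.finprod_cong') (auto intro!: c_mult c_closed act_closed)
  moreover have "(\<lambda>x. c (act x g) h) \<in> B \<rightarrow> carrier A"
    using B g h by (auto intro: c_closed act_closed)
  ultimately show "set_cocycle B (g \<otimes> h) = set_cocycle B g \<otimes>\<^bsub>A\<^esub> set_cocycle (set_act B g) h"
    unfolding set_cocycle_def set_act_def using c by simp
next
  fix B assume "B \<in> {B. B \<subseteq> \<Omega> \<and> finite B}"
  thus "set_act B \<one> = B" unfolding set_act_def by (force simp: act_one)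
qed

lemma set_cocycle_Union:
  assumes "finite \<B>" "pairwise disjnt \<B>" "\<And>B. B \<in> \<B> \<Longrightarrow> B \<subseteq> \<Omega> \<and> finite B" "g \<in> carrier G"
  shows "set_cocycle (\<Union>\<B>) g = finprod A (\<lambda>B. set_cocycle B g) \<B>"
  unfolding set_cocycle_def
  by (subst A.finprod_Union_disjoint) (use assms in \<open>auto intro: c_closed\<close>)

end

section \<open>Orbits of a normal subgroup with small commutators\<close>

lemma (in comm_monoid) finprod_nat_pow:
  assumes "d \<in> carrier G"
  shows "finprod G (\<lambda>i. d [^] i) {..<n::nat} = d [^] (\<Sum>i<n. i)"
  by (induction n) (use assms in \<open>auto simp: lessThan_Suc nat_pow_mult add.commute\<close>)

lemma odd_prime_dvd_sum_lessThan:
  fixes p :: nat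
  assumes "Factorial_Ring.prime p" "p \<noteq> 2"
  shows "p dvd (\<Sum>i<p. i)"
proof -
  have "2 * (\<Sum>i<n. i) = n * (n - 1)" for n :: nat
  proof (induction n)
    case (Suc n)
    thus ?case by (cases n) auto
  qed simp
  hence "p dvd 2 * (\<Sum>i<p. i)" by simp
  moreover have "\<not> p dvd 2"
    using assms primes_dvd_imp_eq two_is_prime_nat by blast
  ultimately show ?thesis using assms(1) prime_dvd_mult_iff by blast
qed

context group
begin

lemma conj_pow:
  assumes "g \<in> carrier G" "x \<in> carrier G"
  shows "(g \<otimes> x \<otimes> inv g) [^] (n::nat) = g \<otimes> x [^] n \<otimes> inv g"
  using assms by (induction n) (simp_all add: m_assoc inv_cancel)

text \<open>The quotient has prime order, so the coset of any \<open>w\<close> outside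
  \<open>M\<close> generates it and has order exactly \<open>p\<close>. Hence the powers of
  \<open>w\<close> with exponent below \<open>p\<close> represent all cosets of
  \<open>M\<close>.\<close>

lemma prime_index_normal_powers:
  assumes "finite (carrier G)" "Factorial_Ring.prime (p::nat)"
    and "M \<lhd> G" "card (rcosets M) = p"
  shows "M \<noteq> carrier G"
    and "\<lbrakk>w \<in> carrier G; w \<notin> M\<rbrakk> \<Longrightarrow> w [^] (n::nat) \<in> M \<longleftrightarrow> p dvd n"
    and "\<lbrakk>w \<in> carrier G; w \<notin> M; g \<in> carrier G\<rbrakk> \<Longrightarrow> \<exists>m \<in> M. \<exists>i<p. g = m \<otimes> w [^] i"
proof -
  interpret M: normal M G by fact
  interpret Q: group "G Mod M" by (rule M.factorgroup_is_group)
  have oQ: "order (G Mod M) = p" using assms(4) by (simp add: order_def FactGroup_def)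
  have finQ: "finite (carrier (G Mod M))"
    using oQ prime_gt_0_nat[OF assms(2)] by (auto simp: order_def intro: card_ge_0_finite)
  have coset_iff: "M #> g = M \<longleftrightarrow> g \<in> M" if "g \<in> carrier G" for g
    using that coset_join1 coset_join2 M.subset M.subgroup_axioms by blast
  show "M \<noteq> carrier G"
  proof
    assume "M = carrier G"
    hence "carrier (G Mod M) \<subseteq> {M}" using coset_iff by (auto simp: carrier_FactGroup)
    hence "p \<le> 1" using oQ card_mono[of "{M}" "carrier (G Mod M)"] by (simp add: order_def)
    thus False using prime_gt_1_nat[OF assms(2)] by simp
  qed
  fix w assume w: "w \<in> carrier G" "w \<notin> M"
  have a: "M #> w \<in> carrier (G Mod M)" using w by (simp add: carrier_FactGroup)
  have pow: "(M #> w) [^]\<^bsub>G Mod M\<^esub> i = M #> w [^] i" for i :: nat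
    using w M.FactGroup_pow by simp
  have "Q.ord (M #> w) dvd p" using Q.ord_dvd_group_order[OF a] oQ by simp
  moreover have "Q.ord (M #> w) \<noteq> 1" using Q.ord_eq_1[OF a] coset_iff w by simp
  ultimately have ord: "Q.ord (M #> w) = p" using assms(2) prime_nat_iff by blast
  show pM: "w [^] n \<in> M \<longleftrightarrow> p dvd n" for n :: nat
    using Q.pow_eq_id[OF a, of n] ord w coset_iff[of "w [^] n"] by (simp add: pow)
  fix g assume g: "g \<in> carrier G"
  let ?I = "(\<lambda>i. M #> w [^] i) ` {0..p - 1}"
  have "inj_on (\<lambda>i. M #> w [^] i) {0..p - 1}"
    using Q.ord_inj[OF a] ord by (simp add: pow)
  hence "card ?I = card (carrier (G Mod M))"
    using oQ prime_gt_0_nat[OF assms(2)] by (simp add: card_image order_def)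
  moreover have "?I \<subseteq> carrier (G Mod M)" using w by (auto simp: carrier_FactGroup)
  ultimately have "?I = carrier (G Mod M)" using card_subset_eq[OF finQ] by blast
  moreover have "M #> g \<in> carrier (G Mod M)" using g by (simp add: carrier_FactGroup)
  ultimately obtain i where i: "i \<in> {0..p - 1}" "M #> g = M #> w [^] i" by (metis (no_types, lifting) imageE)
  have "g \<in> M #> w [^] i" using i(2) rcos_self[OF g M.subgroup_axioms] by simp
  then obtain m where "m \<in> M" "g = m \<otimes> w [^] i" unfolding r_coset_def by blast
  moreover have "i < p" using i(1) prime_gt_0_nat[OF assms(2)] by simp
  ultimately show "\<exists>m \<in> M. \<exists>i<p. g = m \<otimes> w [^] i" by blast
qed

end

context cocycle
begin

text \<open>This treats one \<open>W\<close>-orbit, with \<open>R\<close> inside its stabilizer. The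
  assumption \<open>low\<close> is what minimality of the order of \<open>u\<close> will supply: the
  powers of \<open>u\<close> with exponent divisible by \<open>p\<close> contribute nothing at the
  points they fix.\<close>

lemma set_cocycle_transitive_trivial:
  fixes p :: nat
  assumes fin: "finite (carrier G)" and p: "Factorial_Ring.prime p"
    and R: "subgroup R G" "card R = p ^ n"
    and W: "subgroup W G" "W \<subseteq> R"
    and comm: "\<And>w u. \<lbrakk>w \<in> W; u \<in> R\<rbrakk> \<Longrightarrow>
      w \<otimes> u \<otimes> inv w \<otimes> inv u \<in> power_subgroup G W (if p = 2 then 4 else p)"
    and expA: "\<And>a. a \<in> carrier A \<Longrightarrow> a [^]\<^bsub>A\<^esub> p = \<one>\<^bsub>A\<^esub>"
    and x: "x \<in> \<Omega>" "act x ` R = act x ` W" "\<exists>w \<in> W. act x w \<noteq> x"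
    and u: "u \<in> R"
    and low: "\<And>y k. \<lbrakk>y \<in> \<Omega>; act y (u [^] (p * k)) = y\<rbrakk> \<Longrightarrow> c y (u [^] (p * k)) = \<one>\<^bsub>A\<^esub>"
  shows "set_cocycle (act x ` R) u = \<one>\<^bsub>A\<^esub>"
proof -
  interpret S: cocycle G A "{B. B \<subseteq> \<Omega> \<and> finite B}" set_act set_cocycle by (rule cocycle_sets)
  let ?R = "G\<lparr>carrier := R\<rparr>"
  interpret R: group ?R by (rule subgroup.subgroup_is_group[OF R(1) is_group])
  have RG: "g \<in> carrier G" if "g \<in> R" for g using subgroup.subset[OF R(1)] that by blast
  have finR: "finite R" using finite_subset[OF subgroup.subset[OF R(1)] fin] .
  note Rcl = subgroup.m_closed[OF R(1)] subgroup.m_inv_closed[OF R(1)] subgroup.one_closed[OF R(1)]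
  note Wcl = subgroup.m_closed[OF W(1)] subgroup.m_inv_closed[OF W(1)] subgroup.one_closed[OF W(1)]
  have powR: "g [^]\<^bsub>?R\<^esub> (k::nat) = g [^] k" for g k by (rule nat_pow_consistent[symmetric])
  have Rpow: "g [^] (k::nat) \<in> R" if "g \<in> R" for g k using R.nat_pow_closed[of g k] that by (simp add: powR)
  have Wpow: "g [^] (k::nat) \<in> W" if "g \<in> W" for g k
    using that by (induction k) (auto intro: Wcl)
  \<comment> \<open>The point stabilizer in \<open>R\<close> is proper because some element of
    \<open>W\<close> moves \<open>x\<close>. It therefore lies in a normal subgroup \<open>M\<close>
    of index \<open>p\<close>.\<close>
  define H where "H = {g \<in> R. act x g = x}"
  have "subgroup H G"
  proof (rule subgroupI)
    show "H \<subseteq> carrier G" using RG by (auto simp: H_def)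
    show "H \<noteq> {}" using Rcl(3) x(1) act_one by (auto simp: H_def)
    show "inv g \<in> H" if "g \<in> H" for g
      using that act_inv(1)[OF x(1), of g] Rcl(2) RG by (auto simp: H_def)
    show "g \<otimes> h \<in> H" if "g \<in> H" "h \<in> H" for g h
      using that act_mult[OF x(1), of g h] Rcl(1) RG by (auto simp: H_def)
  qed
  hence HR: "subgroup H ?R" using subgroup_incl R(1) by (auto simp: H_def)
  have "H \<noteq> carrier ?R" using x(3) W(2) by (auto simp: H_def)
  then obtain M where M: "M \<lhd> ?R" "H \<subseteq> M" "card (rcosets\<^bsub>?R\<^esub> M) = p"
    using R.p_group_index_p_subgroup[OF _ p _ HR] finR R(2) by (auto simp: order_def)
  interpret M: normal M ?R by (rule M(1))
  have idx: "M \<noteq> R" "\<And>w k. \<lbrakk>w \<in> R; w \<notin> M\<rbrakk> \<Longrightarrow> w [^] (k::nat) \<in> M \<longleftrightarrow> p dvd k"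
    "\<And>w g. \<lbrakk>w \<in> R; w \<notin> M; g \<in> R\<rbrakk> \<Longrightarrow> \<exists>m \<in> M. \<exists>i<p. g = m \<otimes> w [^] i"
    using R.prime_index_normal_powers[OF _ p M(1,3)] finR by (simp_all add: powR)
  have MR: "M \<subseteq> R" using M.subset by simp
  have sM: "subgroup M G" using incl_subgroup[OF R(1) M.subgroup_axioms] .
  note Mcl = subgroup.m_closed[OF sM] subgroup.m_inv_closed[OF sM] subgroup.one_closed[OF sM]
  have MG: "g \<in> carrier G" if "g \<in> M" for g using MR RG that by blast
  have Mpow: "g [^] (k::nat) \<in> M" if "g \<in> M" for g k
    using that by (induction k) (auto intro: Mcl)
  have Mconj: "g \<otimes> m \<otimes> inv g \<in> M" if "g \<in> R" "m \<in> M" for g m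
    using M.inv_op_closed2[of g m] that m_inv_consistent[OF R(1)] by simp
  \<comment> \<open>As \<open>M\<close> contains the stabilizer of \<open>x\<close>, elements of
    \<open>R\<close> sending \<open>x\<close> to the same point lie in the same coset of
    \<open>M\<close>.\<close>
  have stab: "a \<otimes> inv b \<in> M" if "a \<in> R" "b \<in> R" "act x a = act x b" for a b
  proof -
    have "act x (a \<otimes> inv b) = x" using that x(1) RG act_inv(1)[OF x(1), of b] by (simp add: act_mult)
    thus ?thesis using M(2) that Rcl by (auto simp: H_def)
  qed
  define B0 where "B0 = act x ` M"
  have B0: "B0 \<in> {B. B \<subseteq> \<Omega> \<and> finite B}"
    using x(1) MG act_closed finite_subset[OF MR finR] by (auto simp: B0_def)
  have shift: "set_act (act x ` K) g = act x ` K" if K: "subgroup K G" "g \<in> K" for K g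
  proof -
    have KG: "h \<in> carrier G" if "h \<in> K" for h using subgroup.subset[OF K(1)] that by blast
    have "set_act (act x ` K) g = act x ` ((\<lambda>h. h \<otimes> g) ` K)"
      unfolding set_act_def image_image using x(1) KG K(2) by (intro image_cong) (auto simp: act_mult)
    moreover have "(\<lambda>h. h \<otimes> g) ` K = K"
      using subgroup.rcos_const[OF K(1) is_group K(2)] unfolding r_coset_def by blast
    ultimately show ?thesis by simp
  qed
  have B0M: "set_act B0 m = B0" if "m \<in> M" for m using shift[OF sM that] by (simp add: B0_def)
  \<comment> \<open>Every element of \<open>M\<close> preserves \<open>B0\<close>, so the block
    cocycle restricts to a homomorphism on \<open>M\<close>; it kills \<open>p\<close>-th powers
    because \<open>A\<close> has exponent dividing \<open>p\<close>.\<close>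
  define \<nu> where "\<nu> = set_cocycle B0"
  have \<nu>_closed [simp]: "\<nu> m \<in> carrier A" if "m \<in> carrier G" for m
    using S.c_closed[OF B0 that] by (simp add: \<nu>_def)
  have \<nu>_mult: "\<nu> (m \<otimes> m') = \<nu> m \<otimes>\<^bsub>A\<^esub> \<nu> m'" if "m \<in> M" "m' \<in> M" for m m'
    using S.c_mult[OF B0] MG B0M that by (simp add: \<nu>_def)
  have \<nu>_pow: "\<nu> (m [^] p) = \<one>\<^bsub>A\<^esub>" if "m \<in> M" for m
    using S.c_pow_fixed[OF B0 MG[OF that] B0M[OF that], of p] expA[OF S.c_closed[OF B0 MG[OF that]]] by (simp add: \<nu>_def)
  have \<nu>_conj: "set_cocycle (set_act B0 h) m = \<nu> (h \<otimes> m \<otimes> inv h)" if "h \<in> R" "m \<in> M" for h m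
    using S.c_conj[OF B0 RG[OF that(1)] MG[OF that(2)]] B0M[OF Mconj[OF that]] by (simp add: \<nu>_def)
  \<comment> \<open>The cosets of \<open>M\<close> are represented by \<open>w [^] i\<close> with
    \<open>i < p\<close>. By \<open>stab\<close> distinct cosets give disjoint parts of the orbit,
    so the orbit is the disjoint union of \<open>p\<close> translates of \<open>B0\<close>.\<close>
  have decomp: "set_cocycle (act x ` R) g = finprod A (\<lambda>i. set_cocycle (set_act B0 (w [^] i)) g) {..<p}"
    if w: "w \<in> R" "w \<notin> M" and g: "g \<in> R" for w g
  proof -
    let ?b = "\<lambda>i::nat. set_act B0 (w [^] i)"
    have b: "?b i = (\<lambda>m. act x (m \<otimes> w [^] i)) ` M" for i
      unfolding set_act_def B0_def image_image using x(1) MG RG[OF w(1)]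
      by (intro image_cong) (auto simp: act_mult)
    have disj: "disjnt (?b i) (?b j)" if ij: "i < p" "j < i" for i j
      unfolding disjnt_iff
    proof (intro allI notI, elim conjE)
      fix y assume "y \<in> ?b i" "y \<in> ?b j"
      then obtain m m' where m: "m \<in> M" "m' \<in> M" "act x (m \<otimes> w [^] i) = act x (m' \<otimes> w [^] j)"
        unfolding b by auto
      hence "m \<otimes> w [^] i \<otimes> inv (m' \<otimes> w [^] j) \<in> M"
        using MR Rpow[OF w(1)] Rcl by (intro stab) auto
      from Mcl(1)[OF Mcl(1)[OF Mcl(2)[OF m(1)] this] m(2)]
      have "inv m \<otimes> (m \<otimes> w [^] i \<otimes> inv (m' \<otimes> w [^] j)) \<otimes> m' \<in> M" .
      also have "inv m \<otimes> (m \<otimes> w [^] i \<otimes> inv (m' \<otimes> w [^] j)) \<otimes> m' = w [^] i \<otimes> inv (w [^] j)"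
        using m MG RG[OF w(1)] by (simp add: m_assoc inv_mult_group inv_cancel)
      also have "w [^] i = w [^] (i - j) \<otimes> w [^] j"
        using ij RG[OF w(1)] by (simp add: nat_pow_mult)
      finally have "w [^] (i - j) \<in> M" using RG[OF w(1)] by (simp add: m_assoc)
      hence "p dvd i - j" using idx(2)[OF w] by blast
      thus False using ij by (auto dest: dvd_imp_le)
    qed
    have ne: "?b i \<noteq> {}" for i unfolding b using Mcl(3) by blast
    have dij: "disjnt (?b i) (?b j)" if "i < p" "j < p" "i \<noteq> j" for i j
      using disj[of i j] disj[of j i] that disjnt_sym by (metis nat_neq_iff)
    have inj: "inj_on ?b {..<p}"
    proof (rule inj_onI, rule ccontr)
      fix i j assume "i \<in> {..<p}" "j \<in> {..<p}" "?b i = ?b j" "i \<noteq> j"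
      thus False using dij[of i j] ne[of i] by (simp add: disjnt_def)
    qed
    have "\<Union>(?b ` {..<p}) = act x ` R"
    proof (intro equalityI subsetI)
      fix y assume "y \<in> \<Union>(?b ` {..<p})"
      then obtain i where "y \<in> ?b i" by blast
      then obtain m where "m \<in> M" "y = act x (m \<otimes> w [^] i)" unfolding b by blast
      moreover have "m \<otimes> w [^] i \<in> R" using Rcl(1) MR Rpow[OF w(1)] \<open>m \<in> M\<close> by auto
      ultimately show "y \<in> act x ` R" by blast
    next
      fix y assume "y \<in> act x ` R"
      then obtain h where "h \<in> R" "y = act x h" by blast
      moreover obtain m i where "m \<in> M" "i < p" "h = m \<otimes> w [^] i"
        using idx(3)[OF w \<open>h \<in> R\<close>] by blast
      ultimately have "y \<in> ?b i" unfolding b by blast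
      thus "y \<in> \<Union>(?b ` {..<p})" using \<open>i < p\<close> by blast
    qed
    moreover have "set_cocycle (\<Union>(?b ` {..<p})) g = finprod A (\<lambda>B. set_cocycle B g) (?b ` {..<p})"
    proof (rule set_cocycle_Union)
      show "pairwise disjnt (?b ` {..<p})" using dij by (auto simp: pairwise_def)
      fix B assume "B \<in> ?b ` {..<p}"
      thus "B \<subseteq> \<Omega> \<and> finite B" using S.act_closed[OF B0] RG[OF Rpow[OF w(1)]] by blast
    qed (use RG g in auto)
    moreover have "\<dots> = finprod A (\<lambda>i. set_cocycle (?b i) g) {..<p}"
      using S.act_closed[OF B0] RG[OF Rpow[OF w(1)]] RG[OF g]
      by (intro A.finprod_reindex inj) (auto intro!: S.c_closed)
    ultimately show ?thesis by simp
  qed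
  \<comment> \<open>Evaluated at \<open>w\<close> itself, the \<open>p\<close> factors are those of
    the power formula for the block \<open>B0\<close> at \<open>w [^] p\<close>.\<close>
  have outside: "set_cocycle (act x ` R) w = \<nu> (w [^] p)" if "w \<in> R" "w \<notin> M" for w
    using decomp[OF that that(1)] S.c_pow[OF B0 RG[OF that(1)], of p] by (simp add: \<nu>_def)
  show ?thesis
  proof (cases "u \<in> M")
    case False
    have pM: "u [^] p \<in> M" using idx(2)[OF u False] by simp
    \<comment> \<open>Cycle evaluation of \<open>u [^] p\<close> on the points of \<open>B0\<close>
      only involves powers of \<open>u\<close> with exponent \<open>p * k\<close>, which
      \<open>low\<close> covers.\<close>
    have "\<nu> (u [^] p) = \<one>\<^bsub>A\<^esub>"
      unfolding \<nu>_def set_cocycle_def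
    proof (rule cycles_trivial[OF fin])
      fix y k assume y: "y \<in> B0" "act y ((u [^] p) [^] (k::nat)) = y"
      thus "c y ((u [^] p) [^] k) = \<one>\<^bsub>A\<^esub>"
        using low[of y k] B0 RG[OF u] by (auto simp: nat_pow_pow)
    qed (use B0 RG[OF u] B0M[OF pM] in \<open>auto simp: set_act_def\<close>)
    thus ?thesis using outside[OF u False] by simp
  next
    case True
    \<comment> \<open>Transitivity of \<open>W\<close> on the orbit writes every \<open>g\<close> in
      \<open>R\<close> as an element of \<open>M\<close> times an element of \<open>W\<close>, so
      \<open>W \<subseteq> M\<close> would force \<open>M = R\<close>.\<close>
    have "\<not> W \<subseteq> M"
    proof
      assume "W \<subseteq> M"
      have "g \<in> M" if g: "g \<in> R" for g
      proof -
        obtain w where w: "w \<in> W" "act x g = act x w" using x(2) g by blast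
        have "g \<otimes> inv w \<in> M" using stab[OF g _ w(2)] w(1) W(2) by blast
        moreover have "w \<in> M" using w(1) \<open>W \<subseteq> M\<close> by blast
        ultimately have "g \<otimes> inv w \<otimes> w \<in> M" by (rule Mcl(1))
        thus ?thesis using RG[OF g] w W(2) RG by (simp add: m_assoc subset_iff)
      qed
      thus False using MR idx(1) by blast
    qed
    then obtain w where w: "w \<in> W" "w \<in> R" "w \<notin> M" using W(2) by blast
    note wG = RG[OF w(2)] and uG = RG[OF u]
    \<comment> \<open>\<open>K\<close> is where conjugation by \<open>w\<close> leaves \<nu>
      unchanged, and \<open>L\<close> is the kernel of \<nu>. The power subgroup of \<open>W\<close>
      will lie in \<open>K\<close>, and for \<open>p = 2\<close> even in \<open>L\<close>.\<close>
    define K where "K = {y \<in> M. \<nu> (w \<otimes> y \<otimes> inv w) = \<nu> y}"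
    define L where "L = {y \<in> M. \<nu> y = \<one>\<^bsub>A\<^esub>}"
    have \<nu>_inv: "\<nu> (inv y) = inv\<^bsub>A\<^esub> \<nu> y" if "y \<in> M" for y
    proof -
      have "\<nu> y \<otimes>\<^bsub>A\<^esub> \<nu> (inv y) = \<nu> \<one>" using \<nu>_mult[of y "inv y"] Mcl(2) that MG by simp
      also have "\<dots> = \<one>\<^bsub>A\<^esub>" using S.c_one[OF B0] by (simp add: \<nu>_def)
      finally show ?thesis using that MG by (metis A.inv_equality A.m_comm \<nu>_closed inv_closed)
    qed
    have \<nu>_one: "\<nu> \<one> = \<one>\<^bsub>A\<^esub>" using S.c_one[OF B0] by (simp add: \<nu>_def)
    have sL: "subgroup L G"
      by (rule subgroupI) (use MG Mcl \<nu>_one \<nu>_inv \<nu>_mult in \<open>auto simp: L_def\<close>)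
    have conj_mult: "w \<otimes> (a \<otimes> b) \<otimes> inv w = (w \<otimes> a \<otimes> inv w) \<otimes> (w \<otimes> b \<otimes> inv w)"
      if "a \<in> carrier G" "b \<in> carrier G" for a b
      using wG that by (simp add: m_assoc inv_cancel)
    have sK: "subgroup K G"
    proof (rule subgroupI)
      show "K \<subseteq> carrier G" using MG by (auto simp: K_def)
      show "K \<noteq> {}" using Mcl(3) wG by (auto simp: K_def)
      show "inv a \<in> K" if "a \<in> K" for a
      proof -
        have "w \<otimes> inv a \<otimes> inv w = inv (w \<otimes> a \<otimes> inv w)"
          using wG that MG by (simp add: K_def inv_mult_group m_assoc)
        thus ?thesis using that \<nu>_inv[of a] \<nu>_inv[of "w \<otimes> a \<otimes> inv w"] Mconj[OF w(2)] Mcl(2)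
          by (simp add: K_def)
      qed
      show "a \<otimes> b \<in> K" if "a \<in> K" "b \<in> K" for a b
        using that Mcl(1) MG Mconj[OF w(2)] by (simp add: K_def conj_mult \<nu>_mult)
    qed
    have powM: "y [^] p \<in> M" if "y \<in> R" for y
      using idx(2)[of y p] Mpow[of y p] that by (cases "y \<in> M") auto
    have powK: "y [^] p \<in> K" if y: "y \<in> W" for y
    proof -
      have yR: "y \<in> R" using W(2) y by blast
      let ?y = "w \<otimes> y \<otimes> inv w"
      have yR': "?y \<in> R" by (rule Rcl(1)[OF Rcl(1)[OF w(2) yR] Rcl(2)[OF w(2)]])
      have pw: "?y [^] p = w \<otimes> y [^] p \<otimes> inv w" using conj_pow wG RG[OF yR] by simp
      have "\<nu> (?y [^] p) = \<nu> (y [^] p)"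
      proof (cases "y \<in> M")
        case True
        thus ?thesis using \<nu>_pow Mconj[OF w(2)] by simp
      next
        case False
        have "?y \<notin> M"
        proof
          assume "?y \<in> M"
          from Mconj[OF Rcl(2)[OF w(2)] this] have "inv w \<otimes> ?y \<otimes> inv (inv w) \<in> M" .
          thus False using False wG RG[OF yR] by (simp add: m_assoc inv_cancel)
        qed
        \<comment> \<open>here \<open>\<nu> (y^p)\<close> is the value at \<open>y\<close> of a class function on \<open>R\<close>\<close>
        hence "\<nu> (?y [^] p) = set_cocycle (act x ` R) ?y" using outside[OF yR'] by simp
        also have "\<dots> = set_cocycle (set_act (act x ` R) w) y"
        proof (rule S.c_conj[symmetric])
          show "act x ` R \<in> {B. B \<subseteq> \<Omega> \<and> finite B}" using x(1) RG act_closed finR by auto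
          show "set_act (act x ` R) ?y = act x ` R" by (rule shift[OF R(1) yR'])
        qed (use wG RG[OF yR] in auto)
        also have "\<dots> = \<nu> (y [^] p)" using shift[OF R(1) w(2)] outside[OF yR False] by simp
        finally show ?thesis .
      qed
      thus ?thesis using powM[OF yR] by (simp add: K_def pw)
    qed
    have powLK: "power_subgroup G W (if p = 2 then 4 else p) \<subseteq> K"
      unfolding power_subgroup_def
    proof (rule generate_subgroup_incl[OF _ sK], safe)
      fix y assume y: "y \<in> W"
      show "y [^] (if p = 2 then 4 else p) \<in> K"
        \<comment> \<open>for \<open>p = 2\<close> use \<open>y^4 = (y^2)^2\<close>\<close>
        using powK[OF y] powK[OF Wpow[OF y, of 2]] W(2) RG y
        by (auto simp: nat_pow_pow subset_iff)
    qed
    \<comment> \<open>Squares of elements of \<open>W\<close> lie in \<open>M\<close>, which has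
      index 2, so fourth powers are squares of elements of \<open>M\<close> and \<nu> kills
      them.\<close>
    have powL: "power_subgroup G W 4 \<subseteq> L" if "p = 2"
      unfolding power_subgroup_def
    proof (rule generate_subgroup_incl[OF _ sL], safe)
      fix y assume y: "y \<in> W"
      have "y [^] (2::nat) \<in> M" using powM[of y] y W(2) \<open>p = 2\<close> by blast
      hence "(y [^] (2::nat)) [^] (2::nat) \<in> L"
        using \<nu>_pow Mpow \<open>p = 2\<close> by (auto simp: L_def)
      thus "y [^] (4::nat) \<in> L" using W(2) RG y by (simp add: nat_pow_pow subset_iff)
    qed
    define d where "d = \<nu> (w \<otimes> u \<otimes> inv w) \<otimes>\<^bsub>A\<^esub> inv\<^bsub>A\<^esub> \<nu> u"
    have dA: "d \<in> carrier A" using wG uG by (simp add: d_def)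
    \<comment> \<open>The commutator \<open>k\<close> of \<open>w [^] i\<close> and \<open>u\<close>
      lies in \<open>K\<close>, so one more conjugation by \<open>w\<close> keeps \<nu> of
      \<open>k\<close> and changes only the factor of \<open>u\<close>, by \<open>d\<close>. Hence
      the progression has constant ratio \<open>d\<close>.\<close>
    have f: "\<nu> (w [^] i \<otimes> u \<otimes> inv (w [^] i)) = \<nu> u \<otimes>\<^bsub>A\<^esub> d [^]\<^bsub>A\<^esub> i" for i :: nat
    proof (induction i)
      case 0
      thus ?case using uG by simp
    next
      case (Suc i)
      define k where "k = w [^] i \<otimes> u \<otimes> inv (w [^] i) \<otimes> inv u"
      have kK: "k \<in> K" using comm[OF Wpow[OF w(1)] u, of i] powLK by (auto simp: k_def)
      hence kM: "k \<in> M" "\<nu> (w \<otimes> k \<otimes> inv w) = \<nu> k" by (auto simp: K_def)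
      have ku: "w [^] i \<otimes> u \<otimes> inv (w [^] i) = k \<otimes> u" using wG uG by (simp add: k_def m_assoc)
      have "w [^] Suc i \<otimes> u \<otimes> inv (w [^] Suc i) = w \<otimes> (w [^] i \<otimes> u \<otimes> inv (w [^] i)) \<otimes> inv w"
        unfolding nat_pow_Suc2[OF wG] using wG uG by (simp add: m_assoc inv_mult_group)
      also have "\<dots> = (w \<otimes> k \<otimes> inv w) \<otimes> (w \<otimes> u \<otimes> inv w)"
        unfolding ku using conj_mult MG kM(1) uG by simp
      also have "\<nu> \<dots> = \<nu> k \<otimes>\<^bsub>A\<^esub> \<nu> (w \<otimes> u \<otimes> inv w)"
        using \<nu>_mult Mconj[OF w(2)] kM True by simp
      also have "\<dots> = \<nu> k \<otimes>\<^bsub>A\<^esub> \<nu> u \<otimes>\<^bsub>A\<^esub> d"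
        using MG kM(1) uG wG by (simp add: d_def A.m_ac A.inv_cancel)
      also have "\<nu> k \<otimes>\<^bsub>A\<^esub> \<nu> u = \<nu> u \<otimes>\<^bsub>A\<^esub> d [^]\<^bsub>A\<^esub> i"
        using Suc.IH \<nu>_mult[OF kM(1) True] by (simp add: ku)
      finally show ?case using dA uG by (simp add: A.m_assoc)
    qed
    have "set_cocycle (act x ` R) u = finprod A (\<lambda>i. \<nu> u \<otimes>\<^bsub>A\<^esub> d [^]\<^bsub>A\<^esub> i) {..<p}"
      unfolding decomp[OF w(2,3) u] using dA uG
      by (intro A.finprod_cong') (auto simp: \<nu>_conj[OF Rpow[OF w(2)] True] f)
    also have "\<dots> = \<nu> u [^]\<^bsub>A\<^esub> p \<otimes>\<^bsub>A\<^esub> d [^]\<^bsub>A\<^esub> (\<Sum>i<p. i)"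
      using dA uG by (subst A.finprod_multf) (auto simp: A.finprod_const A.finprod_nat_pow)
    \<comment> \<open>The exponent is \<open>p * (p - 1) / 2\<close>, a multiple of \<open>p\<close>
      for odd \<open>p\<close>. For \<open>p = 2\<close> it is 1, so \<open>d\<close> itself must be
      trivial; this is where fourth powers are used in place of squares.\<close>
    also have "d [^]\<^bsub>A\<^esub> (\<Sum>i<p. i) = \<one>\<^bsub>A\<^esub>"
    proof (cases "p = 2")
      case p2: True
      have "w \<otimes> u \<otimes> inv w \<otimes> inv u \<in> L"
        using comm[OF w(1) u] powL[OF p2] p2 by auto
      hence "\<nu> (w \<otimes> u \<otimes> inv w \<otimes> inv u) = \<one>\<^bsub>A\<^esub>" by (simp add: L_def)
      hence "d = \<one>\<^bsub>A\<^esub>"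
        using \<nu>_mult[OF Mconj[OF w(2) True] Mcl(2)[OF True]] \<nu>_inv[OF True] by (simp add: d_def)
      thus ?thesis by simp
    next
      case False
      then obtain k where "(\<Sum>i<p. i) = p * k" using odd_prime_dvd_sum_lessThan[OF p] by blast
      thus ?thesis using expA dA by (simp add: A.nat_pow_pow[symmetric])
    qed
    finally show ?thesis using expA uG by simp
  qed
qed

end

section \<open>Counting in quotients and elementary abelian quotients\<close>

lemma (in group_hom) card_image_times_kernel:
  "card (h ` carrier G) * card (kernel G H h) = order G"
proof -
  have "bij_betw (\<lambda>K. the_elem (h ` K)) (carrier (G Mod kernel G H h)) (h ` carrier G)"
  proof -
    \<comment> \<open>Shrinking the target to the image makes the map onto, as the isomorphism
      theorem requires.\<close>
    let ?I = "H\<lparr>carrier := h ` carrier G\<rparr>"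
    have "group ?I" by (rule subgroup.subgroup_is_group[OF img_is_subgroup H.is_group])
    moreover have "h \<in> hom G ?I" by (auto simp: hom_def)
    ultimately have "group_hom G ?I h"
      by (simp add: group_hom_def group_hom_axioms_def)
    from group_hom.FactGroup_iso_set[OF this] show ?thesis
      by (simp add: iso_def kernel_def)
  qed
  hence "card (h ` carrier G) = card (rcosets kernel G H h)"
    by (metis bij_betw_same_card FactGroup_def partial_object.select_convs(1))
  thus ?thesis using G.lagrange[OF subgroup_kernel] by simp
qed

lemma hom_finprod_comm_monoid:
  assumes "comm_monoid A" "comm_monoid B" "h \<in> hom A B" "h \<one>\<^bsub>A\<^esub> = \<one>\<^bsub>B\<^esub>"
    and "f \<in> S \<rightarrow> carrier A"
  shows "h (finprod A f S) = finprod B (\<lambda>i. h (f i)) S"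
proof -
  interpret A: comm_monoid A by fact
  interpret B: comm_monoid B by fact
  show ?thesis using assms(5)
  proof (induction S rule: infinite_finite_induct)
    case (insert a S)
    have "f \<in> S \<rightarrow> carrier A" "f a \<in> carrier A" using insert.prems by auto
    thus ?case using insert hom_in_carrier[OF assms(3)]
      by (simp add: hom_mult[OF assms(3)] Pi_iff)
  qed (simp_all add: assms(4))
qed

context group
begin

text \<open>The coset of \<open>x\<close> is nontrivial and its order is a power of \<open>p\<close>
  dividing the order of the quotient.\<close>

lemma prime_dvd_index_of_normal:
  assumes "Factorial_Ring.prime (p::nat)" "finite (carrier G)" "D \<lhd> G"
    and "x \<in> carrier G" "x \<notin> D" "x [^] (p ^ n) = \<one>"
  shows "p dvd card (rcosets D)"
proof (rule ccontr)
  assume np: "\<not> p dvd card (rcosets D)"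
  interpret D: normal D G by fact
  interpret Q: group "G Mod D" by (rule D.factorgroup_is_group)
  have a: "D #> x \<in> carrier (G Mod D)" using assms(4) by (simp add: carrier_FactGroup)
  have "(D #> x) [^]\<^bsub>G Mod D\<^esub> (p ^ n) = \<one>\<^bsub>G Mod D\<^esub>"
    using assms(4,6) D.FactGroup_pow D.subset by simp
  hence "Q.ord (D #> x) dvd p ^ n" using Q.pow_eq_id[OF a] by simp
  moreover have "Q.ord (D #> x) dvd card (rcosets D)"
    using Q.ord_dvd_group_order[OF a] by (simp add: order_def FactGroup_def)
  ultimately have "Q.ord (D #> x) = 1"
    using np assms(1) by (metis coprime_common_divisor_nat coprime_commute coprime_power_left_iff
        prime_imp_coprime_nat One_nat_def is_unit_gcd coprime_def nat_dvd_1_iff_1)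
  hence "D #> x = D" using Q.ord_eq_1[OF a] by simp
  thus False using assms(4,5) coset_join1[OF _ _ D.subgroup_axioms] by blast
qed

end

text \<open>Take \<open>C\<close> to be the product of \<open>J\<close> with the subgroup of
  \<open>p\<close>-th powers. If it were the whole group, the \<open>p\<close>-th power map would be
  onto the finite quotient by \<open>J\<close>, hence injective there, yet this quotient has a
  subgroup of order \<open>p\<close>.\<close>

lemma (in comm_group) elementary_abelian_quotient:
  fixes p :: nat
  assumes "finite (carrier G)" "Factorial_Ring.prime p" "subgroup J G" "p dvd card (rcosets J)"
  obtains C where "subgroup C G" "J \<subseteq> C" "C \<noteq> carrier G" "\<And>b. b \<in> carrier G \<Longrightarrow> b [^] p \<in> C"
proof -
  let ?pw = "(\<lambda>b. b [^] p) ` carrier G"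
  have "(\<lambda>b. b [^] p) \<in> hom G G" by (auto simp: hom_def pow_mult_distrib m_comm)
  then interpret h: group_hom G G "\<lambda>b. b [^] p" by unfold_locales
  have pw: "subgroup ?pw G" by (rule h.img_is_subgroup)
  define C where "C = J <#> ?pw"
  have Jone: "\<one> \<in> J" and JG: "J \<subseteq> carrier G"
    using subgroup.one_closed[OF assms(3)] subgroup.subset[OF assms(3)] by auto
  show ?thesis
  proof (rule that)
    show "subgroup C G" unfolding C_def by (rule mult_subgroups[OF assms(3) pw])
    show "J \<subseteq> C"
    proof
      fix j assume "j \<in> J"
      moreover have "\<one> \<in> ?pw" using subgroup.one_closed[OF pw] .
      moreover have "j = j \<otimes> \<one>" using \<open>j \<in> J\<close> JG by auto
      ultimately show "j \<in> C" unfolding C_def set_mult_def by blast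
    qed
    show "b [^] p \<in> C" if "b \<in> carrier G" for b
    proof -
      have "b [^] p = \<one> \<otimes> b [^] p" using that by simp
      thus ?thesis using Jone that unfolding C_def set_mult_def by blast
    qed
    show "C \<noteq> carrier G"
    proof
      assume C: "C = carrier G"
      interpret J: normal J G by (rule subgroup_imp_normal[OF assms(3)])
      interpret Q: comm_group "G Mod J" by (rule abelian_FactGroup[OF assms(3)])
      let ?Q = "carrier (G Mod J)"
      have oQ: "order (G Mod J) = card (rcosets J)" by (simp add: order_def FactGroup_def)
      have finQ: "finite ?Q" using assms(1) by (simp add: carrier_FactGroup)
      have "?Q \<subseteq> (\<lambda>a. a [^]\<^bsub>G Mod J\<^esub> p) ` ?Q"
      proof
        fix a assume "a \<in> ?Q"
        then obtain g where g: "g \<in> carrier G" "a = J #> g" by (auto simp: carrier_FactGroup)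
        then obtain j b where jb: "j \<in> J" "b \<in> carrier G" "g = j \<otimes> b [^] p"
          using C unfolding C_def set_mult_def by blast
        have "J #> g = J #> j #> b [^] p" using jb JG by (auto simp: coset_mult_assoc)
        also have "J #> j = J" using jb(1) J.rcos_const[OF is_group] by simp
        also have "J #> b [^] p = (J #> b) [^]\<^bsub>G Mod J\<^esub> p" using J.FactGroup_pow jb(2) by simp
        finally show "a \<in> (\<lambda>a. a [^]\<^bsub>G Mod J\<^esub> p) ` ?Q" using g(2) jb(2) by (auto simp: carrier_FactGroup)
      qed
      moreover have "(\<lambda>a. a [^]\<^bsub>G Mod J\<^esub> p) ` ?Q \<subseteq> ?Q" by auto
      ultimately have inj: "inj_on (\<lambda>a. a [^]\<^bsub>G Mod J\<^esub> p) ?Q"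
        using finQ by (intro eq_card_imp_inj_on) auto
      obtain m where m: "card (rcosets J) = p ^ 1 * m" using assms(4) by auto
      obtain L where L: "subgroup L (G Mod J)" "card L = p"
        using sylow_thm[OF assms(2) Q.is_group _ finQ, of 1 m] oQ m by auto
      interpret L: group "(G Mod J)\<lparr>carrier := L\<rparr>"
        by (rule subgroup.subgroup_is_group[OF L(1) Q.is_group])
      have "a = \<one>\<^bsub>G Mod J\<^esub>" if a: "a \<in> L" for a
      proof -
        have aQ: "a \<in> ?Q" using a subgroup.subset[OF L(1)] by blast
        have "a [^]\<^bsub>G Mod J\<^esub> p = \<one>\<^bsub>G Mod J\<^esub>"
          using L.pow_order_eq_1[of a] a L(2) by (simp add: order_def flip: Q.nat_pow_consistent)
        thus ?thesis using inj_onD[OF inj _ aQ Q.one_closed] Q.nat_pow_one[of p] by simp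
      qed
      hence "L \<subseteq> {\<one>\<^bsub>G Mod J\<^esub>}" by blast
      hence "card L \<le> 1" using card_mono[of "{\<one>\<^bsub>G Mod J\<^esub>}" L] by simp
      thus False using L(2) prime_gt_1_nat[OF assms(2)] by simp
    qed
  qed
qed

section \<open>Products over whole sets of points\<close>

context cocycle
begin

text \<open>The whole set is a block fixed by every \<open>g\<close>, so the crossed homomorphism
  rule becomes multiplicativity. Applied to cosets, this is the fact that transfer is a
  homomorphism.\<close>

lemma set_cocycle_hom:
  assumes "finite \<Omega>"
  shows "set_cocycle \<Omega> \<in> hom G A"
proof -
  interpret S: cocycle G A "{B. B \<subseteq> \<Omega> \<and> finite B}" set_act set_cocycle by (rule cocycle_sets)
  have "set_act \<Omega> g = \<Omega>" if "g \<in> carrier G" for g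
    unfolding set_act_def
    by (rule endo_inj_surj) (use assms act_closed inj_on_act that in auto)
  thus ?thesis using assms S.c_mult S.c_closed by (intro homI) auto
qed

text \<open>\<open>P\<close> normalizes \<open>W\<close> and so permutes the \<open>W\<close>-orbits
  in \<open>S\<close>. Cycle evaluation on these orbits leaves the value of an orbit
  \<open>B\<close> at some \<open>u [^] k\<close> stabilizing it, and the transitive case shows this
  value to be trivial.\<close>

lemma set_cocycle_no_fixed_points_trivial:
  fixes p :: nat
  assumes fin: "finite (carrier G)" and p: "Factorial_Ring.prime p"
    and P: "subgroup P G" "card P = p ^ n"
    and W: "subgroup W G" "W \<subseteq> P" "\<And>g w. \<lbrakk>g \<in> P; w \<in> W\<rbrakk> \<Longrightarrow> g \<otimes> w \<otimes> inv g \<in> W"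
    and comm: "\<And>w u. \<lbrakk>w \<in> W; u \<in> P\<rbrakk> \<Longrightarrow>
      w \<otimes> u \<otimes> inv w \<otimes> inv u \<in> power_subgroup G W (if p = 2 then 4 else p)"
    and expA: "\<And>a. a \<in> carrier A \<Longrightarrow> a [^]\<^bsub>A\<^esub> p = \<one>\<^bsub>A\<^esub>"
    and S: "finite S" "S \<subseteq> \<Omega>" "\<And>x g. \<lbrakk>x \<in> S; g \<in> P\<rbrakk> \<Longrightarrow> act x g \<in> S"
    and nofix: "\<And>x. x \<in> S \<Longrightarrow> \<exists>w \<in> W. act x w \<noteq> x"
    and u: "u \<in> P"
    and low: "\<And>y k. \<lbrakk>y \<in> \<Omega>; act y (u [^] (p * k)) = y\<rbrakk> \<Longrightarrow> c y (u [^] (p * k)) = \<one>\<^bsub>A\<^esub>"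
  shows "set_cocycle S u = \<one>\<^bsub>A\<^esub>"
proof -
  interpret S: cocycle G A "{B. B \<subseteq> \<Omega> \<and> finite B}" set_act set_cocycle by (rule cocycle_sets)
  have PG: "g \<in> carrier G" if "g \<in> P" for g using subgroup.subset[OF P(1)] that by blast
  have WG: "g \<in> carrier G" if "g \<in> W" for g using W(2) PG that by blast
  have finP: "finite P" using finite_subset[OF subgroup.subset[OF P(1)] fin] .
  note Pcl = subgroup.m_closed[OF P(1)] subgroup.m_inv_closed[OF P(1)] subgroup.one_closed[OF P(1)]
  note Wcl = subgroup.m_closed[OF W(1)] subgroup.m_inv_closed[OF W(1)] subgroup.one_closed[OF W(1)]
  have upow: "u [^] (k::nat) \<in> P" for k by (induction k) (auto intro: Pcl u)
  let ?orb = "\<lambda>x. act x ` W"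
  have orb_refl: "x \<in> ?orb x" if "x \<in> S" for x
    using Wcl(3) act_one[of x] S(2) that by force
  have orbS: "?orb x \<subseteq> S" if "x \<in> S" for x using S(3) that W(2) by auto
  have orb_eq: "?orb (act x w) = ?orb x" if "x \<in> S" "w \<in> W" for x w
  proof -
    have x: "x \<in> \<Omega>" using that S(2) by blast
    have "?orb (act x w) = act x ` ((\<lambda>h. w \<otimes> h) ` W)"
      unfolding image_image using x WG that(2) by (intro image_cong) (auto simp: act_mult)
    moreover have "(\<lambda>h. w \<otimes> h) ` W = W"
      using coset_join3[OF WG[OF that(2)] W(1) that(2)] unfolding l_coset_def by blast
    ultimately show ?thesis by simp
  qed
  have orb_act: "set_act (?orb x) g = ?orb (act x g)" if "x \<in> S" "g \<in> P" for x g
  proof -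
    have x: "x \<in> \<Omega>" using that S(2) by blast
    have *: "act (act x w) g = act (act x g) (inv g \<otimes> w \<otimes> g)" if "w \<in> W" for w
      using x WG[OF that] PG[OF \<open>g \<in> P\<close>] by (simp add: m_assoc inv_cancel flip: act_mult)
    have **: "inv g \<otimes> w \<otimes> g \<in> W" if "w \<in> W" for w
      using W(3)[OF Pcl(2)[OF \<open>g \<in> P\<close>] that] PG[OF \<open>g \<in> P\<close>] by simp
    have ***: "act (act x g) w = act (act x (g \<otimes> w \<otimes> inv g)) g" if "w \<in> W" for w
      using x WG[OF that] PG[OF \<open>g \<in> P\<close>] by (simp add: m_assoc flip: act_mult)
    show ?thesis
    proof (intro equalityI subsetI)
      fix y assume "y \<in> set_act (?orb x) g"
      then obtain w where "w \<in> W" "y = act (act x w) g" unfolding set_act_def by blast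
      thus "y \<in> ?orb (act x g)" using *[of w] **[of w] by blast
    next
      fix y assume "y \<in> ?orb (act x g)"
      then obtain w where "w \<in> W" "y = act (act x g) w" by blast
      thus "y \<in> set_act (?orb x) g"
        using ***[of w] W(3)[OF \<open>g \<in> P\<close>, of w] unfolding set_act_def by blast
    qed
  qed
  have disj: "pairwise disjnt (?orb ` S)"
  proof (rule pairwiseI)
    fix B C assume BC: "B \<in> ?orb ` S" "C \<in> ?orb ` S" "B \<noteq> C"
    then obtain x y where xy: "x \<in> S" "B = ?orb x" "y \<in> S" "C = ?orb y" by blast
    show "disjnt B C"
    proof (rule ccontr)
      assume "\<not> disjnt B C"
      then obtain w w' where w: "w \<in> W" "w' \<in> W" "act x w = act y w'"
        unfolding disjnt_iff xy by blast
      have "B = ?orb (act x w)" using orb_eq[OF xy(1) w(1)] xy(2) by simp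
      also have "\<dots> = C" using orb_eq[OF xy(3) w(2)] xy(4) w(3) by simp
      finally show False using BC(3) by simp
    qed
  qed
  have Un: "\<Union>(?orb ` S) = S"
  proof (intro equalityI subsetI)
    fix y assume "y \<in> \<Union>(?orb ` S)"
    then obtain x where "x \<in> S" "y \<in> ?orb x" by blast
    thus "y \<in> S" using orbS by blast
  qed (use orb_refl in blast)
  have blocks: "B \<subseteq> \<Omega> \<and> finite B" if "B \<in> ?orb ` S" for B
  proof -
    from that obtain x where "x \<in> S" "B = ?orb x" by blast
    thus ?thesis using orbS[of x] S(1,2) finite_subset by blast
  qed
  have "set_cocycle S u = finprod A (\<lambda>B. set_cocycle B u) (?orb ` S)"
    using set_cocycle_Union[OF _ disj blocks PG[OF u]] S(1) Un by simp
  also have "\<dots> = \<one>\<^bsub>A\<^esub>"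
  proof (rule S.cycles_trivial[OF fin PG[OF u]])
    fix B assume "B \<in> ?orb ` S"
    then obtain x where "x \<in> S" "B = ?orb x" by blast
    thus "set_act B u \<in> ?orb ` S" using orb_act[OF _ u] S(3)[OF _ u] by blast
  next
    fix B k assume B: "B \<in> ?orb ` S" "set_act B (u [^] (k::nat)) = B"
    then obtain x where x: "x \<in> S" "B = ?orb x" by blast
    have xO: "x \<in> \<Omega>" using S(2) x(1) by blast
    have Bin: "B \<in> {B. B \<subseteq> \<Omega> \<and> finite B}" using blocks[OF B(1)] by blast
    \<comment> \<open>The stabilizer of \<open>B\<close> in \<open>P\<close> contains
      \<open>W\<close>, because \<open>B\<close> is a \<open>W\<close>-orbit. It maps
      \<open>x\<close> into \<open>B\<close>, so its orbit through \<open>x\<close> is again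
      \<open>B\<close>.\<close>
    define R where "R = {g \<in> P. set_act B g = B}"
    have R: "subgroup R G"
    proof (rule subgroupI)
      show "R \<subseteq> carrier G" using PG by (auto simp: R_def)
      show "R \<noteq> {}" using Pcl(3) S.act_one[OF Bin] by (auto simp: R_def)
      show "inv g \<in> R" if "g \<in> R" for g
        using that S.act_inv(1)[OF Bin, of g] Pcl(2) PG by (auto simp: R_def)
      show "g \<otimes> h \<in> R" if "g \<in> R" "h \<in> R" for g h
        using that S.act_mult[OF Bin, of g h] Pcl(1) PG by (auto simp: R_def)
    qed
    have RP: "R \<subseteq> P" by (auto simp: R_def)
    have "subgroup R (G\<lparr>carrier := P\<rparr>)" by (rule subgroup_incl[OF R P(1) RP])
    hence "card (rcosets\<^bsub>G\<lparr>carrier := P\<rparr>\<^esub> R) * card R = p ^ n"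
      using group.lagrange[OF subgroup.subgroup_is_group[OF P(1) is_group]] P(2)
      by (simp add: order_def)
    hence "card R dvd p ^ n" by (metis dvd_triv_right)
    then obtain m where m: "card R = p ^ m" using divides_primepow_nat[OF p] by blast
    have WR: "W \<subseteq> R"
    proof
      fix w assume w: "w \<in> W"
      hence "set_act B w = B" using orb_act[OF x(1)] orb_eq[OF x(1)] W(2) x(2) by auto
      thus "w \<in> R" using w W(2) by (auto simp: R_def)
    qed
    have RW: "act x ` R = act x ` W"
    proof
      show "act x ` R \<subseteq> act x ` W"
      proof
        fix y assume "y \<in> act x ` R"
        then obtain g where g: "g \<in> R" "y = act x g" by blast
        hence "y \<in> set_act B g" using orb_refl[OF x(1)] x(2) by (auto simp: set_act_def)
        thus "y \<in> act x ` W" using g(1) x(2) by (simp add: R_def)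
      qed
    qed (use WR in blast)
    have "set_cocycle (act x ` R) (u [^] k) = \<one>\<^bsub>A\<^esub>"
    proof (rule set_cocycle_transitive_trivial[OF fin p R m W(1) WR _ _ xO RW nofix[OF x(1)]])
      show "u [^] k \<in> R" using upow B(2) by (simp add: R_def)
      fix y j assume y: "y \<in> \<Omega>" "act y ((u [^] k) [^] (p * j)) = y"
      \<comment> \<open>The exponent stays a multiple of \<open>p\<close>, so the assumption
        \<open>low\<close> passes from \<open>u\<close> to \<open>u [^] k\<close>.\<close>
      have "(u [^] k) [^] (p * j) = u [^] (p * (k * j))"
        using PG[OF u] by (simp add: nat_pow_pow mult_ac)
      thus "c y ((u [^] k) [^] (p * j)) = \<one>\<^bsub>A\<^esub>" using low[of y "k * j"] y by simp
    qed (use comm RP expA in auto)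
    thus "set_cocycle B (u [^] k) = \<one>\<^bsub>A\<^esub>" using RW x(2) by simp
  qed (use S(1) blocks in auto)
  finally show ?thesis .
qed

end

section \<open>Transfer\<close>

text \<open>The choice is arbitrary: the representative of the subgroup itself need not be the
  identity.\<close>

definition coset_rep :: "'a set \<Rightarrow> 'a" where
  "coset_rep C = (SOME g. g \<in> C)"

text \<open>The transfer of \<open>f\<close> is the product of these factors over all right cosets.
  Keeping them separate allows the product to be taken over any set of cosets.\<close>

definition transfer_factor ::
    "('a, 'b) monoid_scheme \<Rightarrow> ('a \<Rightarrow> 'c) \<Rightarrow> 'a set \<Rightarrow> 'a \<Rightarrow> 'c" where
  "transfer_factor G f C g = f (coset_rep C \<otimes>\<^bsub>G\<^esub> g \<otimes>\<^bsub>G\<^esub> inv\<^bsub>G\<^esub> coset_rep (C #>\<^bsub>G\<^esub> g))"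

context group
begin

lemma rcosets_act_closed:
  assumes "subgroup H G" "C \<in> rcosets H" "g \<in> carrier G"
  shows "C #> g \<in> rcosets H"
  using assms subgroup.subset[OF assms(1)] unfolding RCOSETS_def by (auto simp: coset_mult_assoc)

lemma coset_rep_in:
  assumes "subgroup H G" "C \<in> rcosets H"
  shows "coset_rep C \<in> C" "coset_rep C \<in> carrier G"
proof -
  obtain g where g: "g \<in> carrier G" "C = H #> g" using assms(2) unfolding RCOSETS_def by blast
  have "g \<in> C" using rcos_self[OF g(1) assms(1)] g(2) by simp
  thus *: "coset_rep C \<in> C" unfolding coset_rep_def by (rule someI)
  thus "coset_rep C \<in> carrier G"
    using subgroup.rcosets_carrier[OF assms(1) is_group assms(2)] by blast
qed

lemma coset_rep_conj_in:
  assumes "subgroup H G" "C \<in> rcosets H" "g \<in> carrier G"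
  shows "coset_rep C \<otimes> g \<otimes> inv coset_rep (C #> g) \<in> H"
proof (rule diff_neutralizes[OF assms(1) rcosets_act_closed[OF assms]])
  show "coset_rep C \<otimes> g \<in> C #> g" using coset_rep_in(1)[OF assms(1,2)] unfolding r_coset_def by blast
  show "coset_rep (C #> g) \<in> C #> g" by (rule coset_rep_in(1)[OF assms(1) rcosets_act_closed[OF assms]])
qed

text \<open>The representative of the intermediate coset \<open>C #> g\<close> telescopes: inserting
  it with its inverse splits the argument of \<open>f\<close> into two elements of
  \<open>H\<close>.\<close>

lemma transfer_cocycle:
  assumes H: "subgroup H G" and A: "comm_group A" and f: "f \<in> hom (G\<lparr>carrier := H\<rparr>) A"
  shows "cocycle G A (rcosets H) (\<lambda>C g. C #> g) (transfer_factor G f)"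
proof -
  interpret A: comm_group A by (rule A)
  note rep = coset_rep_in(2)[OF H]
  show ?thesis
  proof
    fix C g assume C: "C \<in> rcosets H" and g: "g \<in> carrier G"
    have CG: "C \<subseteq> carrier G" by (rule subgroup.rcosets_carrier[OF H is_group C])
    show "C #> g \<in> rcosets H" by (rule rcosets_act_closed[OF H C g])
    show "transfer_factor G f C g \<in> carrier A"
      unfolding transfer_factor_def using hom_in_carrier[OF f] coset_rep_conj_in[OF H C g] by simp
    fix h assume h: "h \<in> carrier G"
    show *: "C #> (g \<otimes> h) = (C #> g) #> h" using CG g h by (simp add: coset_mult_assoc)
    let ?r = "coset_rep C" and ?s = "coset_rep (C #> g)" and ?t = "coset_rep (C #> g #> h)"
    have Cg: "C #> g \<in> rcosets H" by (rule rcosets_act_closed[OF H C g])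
    have car: "?r \<in> carrier G" "?s \<in> carrier G" "?t \<in> carrier G"
      using rep C Cg rcosets_act_closed[OF H Cg h] by auto
    have "?r \<otimes> (g \<otimes> h) \<otimes> inv ?t = (?r \<otimes> g \<otimes> inv ?s) \<otimes> (?s \<otimes> h \<otimes> inv ?t)"
      using car g h by (simp add: m_assoc inv_cancel)
    thus "transfer_factor G f C (g \<otimes> h) =
      transfer_factor G f C g \<otimes>\<^bsub>A\<^esub> transfer_factor G f (C #> g) h"
      unfolding transfer_factor_def *
      using hom_mult[OF f, of "?r \<otimes> g \<otimes> inv ?s" "?s \<otimes> h \<otimes> inv ?t"]
        coset_rep_conj_in[OF H C g] coset_rep_conj_in[OF H Cg h] by simp
  next
    fix C assume C: "C \<in> rcosets H"
    show "C #> \<one> = C" using subgroup.rcosets_carrier[OF H is_group C] by simp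
  qed
qed

lemma transfer_hom:
  assumes "finite (carrier G)" "subgroup H G" "comm_group A" "f \<in> hom (G\<lparr>carrier := H\<rparr>) A"
  shows "(\<lambda>g. finprod A (\<lambda>C. transfer_factor G f C g) (rcosets H)) \<in> hom G A"
proof -
  interpret T: cocycle G A "rcosets H" "\<lambda>C g. C #> g" "transfer_factor G f"
    by (rule transfer_cocycle[OF assms(2-4)])
  have "finite (rcosets H)" using assms(1) rcosets_part_G[OF assms(2)] finite_UnionD by metis
  thus ?thesis using T.set_cocycle_hom unfolding T.set_cocycle_def[abs_def] by simp
qed

lemma hom_comm_group_derived:
  assumes "comm_group A" "f \<in> hom G A" "x \<in> derived G (carrier G)"
  shows "f x = \<one>\<^bsub>A\<^esub>"
proof -
  interpret A: comm_group A by fact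
  interpret f: group_hom G A f using assms(2) by unfold_locales
  have "f ` derived G (carrier G) = {\<one>\<^bsub>A\<^esub>}"
    using f.derived_img[of "carrier G"] A.derived_eq_singleton[of "f ` carrier G"]
    by (simp add: image_subset_iff)
  thus ?thesis using assms(3) by blast
qed

text \<open>Restrict the transfer \<open>V\<close> from \<open>G\<close> to \<open>H\<close> modulo
  its derived subgroup \<open>D\<close> to \<open>H\<close>. Its kernel \<open>K\<close> contains
  \<open>D\<close> and the \<open>p\<close>-element \<open>x\<close> outside \<open>D\<close>, so
  \<open>p\<close> divides the index of \<open>D\<close> in \<open>K\<close>, which is the index of
  the image of \<open>V\<close>. The quotient by this image and all \<open>p\<close>-th powers is
  then nontrivial and serves as \<open>A\<close>. It is a quotient of a quotient of
  \<open>H\<close>, whence the element type.\<close>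

lemma exists_hom_with_trivial_transfer:
  fixes p :: nat
  assumes fin: "finite (carrier G)" and p: "Factorial_Ring.prime p" and H: "subgroup H G"
    and x: "x \<in> H" "x \<in> derived G (carrier G)" "x \<notin> derived G H" "x [^] (p ^ n) = \<one>"
  obtains A :: "'a set set monoid" and f where
    "comm_group A" "f \<in> hom (G\<lparr>carrier := H\<rparr>) A"
    "\<And>a. a \<in> carrier A \<Longrightarrow> a [^]\<^bsub>A\<^esub> p = \<one>\<^bsub>A\<^esub>"
    "\<exists>h \<in> H. f h \<noteq> \<one>\<^bsub>A\<^esub>"
    "\<And>h. h \<in> H \<Longrightarrow> finprod A (\<lambda>C. transfer_factor G f C h) (rcosets H) = \<one>\<^bsub>A\<^esub>"
proof -
  let ?H = "G\<lparr>carrier := H\<rparr>"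
  have HG: "h \<in> carrier G" if "h \<in> H" for h using subgroup.subset[OF H] that by blast
  have finH: "finite H" using finite_subset[OF subgroup.subset[OF H] fin] .
  interpret H: group ?H by (rule subgroup.subgroup_is_group[OF H is_group])
  define D where "D = derived ?H (carrier ?H)"
  have D: "D = derived G H" using derived_consistent[OF subset_refl H] by (simp add: D_def)
  interpret D: normal D ?H unfolding D_def by (rule H.derived_self_is_normal)
  define B where "B = ?H Mod D"
  interpret B: comm_group B unfolding B_def D_def by (rule H.derived_quot_is_comm_group)
  define q where "q = (\<lambda>h. D #>\<^bsub>?H\<^esub> h)"
  have q: "q \<in> hom ?H B" unfolding q_def B_def by (rule D.r_coset_hom_Mod)
  define V where "V = (\<lambda>g. finprod B (\<lambda>C. transfer_factor G q C g) (rcosets H))"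
  have V: "V \<in> hom G B" unfolding V_def by (rule transfer_hom[OF fin H B.comm_group_axioms q])
  hence VH: "V \<in> hom ?H B" using HG by (auto simp: hom_def Pi_iff)
  interpret V: group_hom ?H B V using VH by unfold_locales
  define K where "K = kernel ?H B V"
  have KH: "K \<lhd> ?H" unfolding K_def by (rule V.normal_kernel)
  have sK: "subgroup K ?H" using KH normal_imp_subgroup by blast
  have xK: "x \<in> K" using x(1) hom_comm_group_derived[OF B.comm_group_axioms V x(2)]
    by (simp add: K_def kernel_def)
  have DK: "D \<subseteq> K"
    using H.hom_comm_group_derived[OF B.comm_group_axioms VH] D.subset
    unfolding K_def kernel_def D_def by blast
  let ?K = "?H\<lparr>carrier := K\<rparr>"
  interpret K: group ?K by (rule subgroup.subgroup_is_group[OF sK H.is_group])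
  have DnK: "D \<lhd> ?K" by (rule H.normal_restrict_supergroup[OF sK D.normal_axioms DK])
  have "x [^]\<^bsub>?K\<^esub> (p ^ n) = \<one>"
    using x(4) nat_pow_consistent[of x "p ^ n" K] by simp
  hence pK: "p dvd card (rcosets\<^bsub>?K\<^esub> D)"
    using K.prime_dvd_index_of_normal[OF p _ DnK, of x n] finite_subset[OF subgroup.subset[OF sK]] finH
      xK x(3) D by simp
  have oB: "order B * card D = card H"
    using H.lagrange[OF D.subgroup_axioms] by (simp add: B_def order_def FactGroup_def)
  have oK: "card (rcosets\<^bsub>?K\<^esub> D) * card D = card K"
    using K.lagrange[OF normal_imp_subgroup[OF DnK]] by (simp add: order_def)
  define J where "J = V ` H"
  have J: "subgroup J B" using V.img_is_subgroup by (simp add: J_def)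
  have oJ: "card J * card K = card H"
    using V.card_image_times_kernel by (simp add: J_def K_def order_def)
  have "card (rcosets\<^bsub>B\<^esub> J) * card J = order B" by (rule B.lagrange[OF J])
  \<comment> \<open>Both sides count \<open>H\<close>: through \<open>D\<close> and the image of
    \<open>V\<close> on the left, through \<open>K\<close> on the right. Cancelling equates the two
    indices.\<close>
  hence "card (rcosets\<^bsub>B\<^esub> J) * card J * card D = card J * (card (rcosets\<^bsub>?K\<^esub> D) * card D)"
    using oB oK oJ by simp
  moreover have "card J > 0" "card D > 0"
  proof -
    have "card H > 0" using finH H.one_closed by (auto simp: card_gt_0_iff)
    hence "card J * card K > 0" "order B * card D > 0" using oJ oB by simp_all
    thus "card J > 0" "card D > 0" by simp_all
  qed
  ultimately have "card (rcosets\<^bsub>B\<^esub> J) = card (rcosets\<^bsub>?K\<^esub> D)" by (simp add: mult_ac)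
  moreover have finB: "finite (carrier B)"
    using finH by (simp add: B_def carrier_FactGroup)
  ultimately obtain C where C: "subgroup C B" "J \<subseteq> C" "C \<noteq> carrier B"
    "\<And>b. b \<in> carrier B \<Longrightarrow> b [^]\<^bsub>B\<^esub> p \<in> C"
    using B.elementary_abelian_quotient[OF _ p J] pK by metis
  interpret C: normal C B by (rule B.subgroup_imp_normal[OF C(1)])
  define A where "A = B Mod C"
  interpret A: comm_group A unfolding A_def by (rule B.abelian_FactGroup[OF C(1)])
  define r where "r = (\<lambda>b. C #>\<^bsub>B\<^esub> b)"
  have r: "r \<in> hom B A" unfolding r_def A_def by (rule C.r_coset_hom_Mod)
  have r_one: "r b = \<one>\<^bsub>A\<^esub> \<longleftrightarrow> b \<in> C" if "b \<in> carrier B" for b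
    using that B.coset_join1[OF _ that C(1)] B.coset_join2[OF that C(1)] by (auto simp: r_def A_def)
  have rq: "r \<circ> q \<in> hom ?H A" using q r by (auto simp: hom_def Pi_iff)
  show ?thesis
  proof (rule that[OF A.comm_group_axioms rq])
    fix a assume "a \<in> carrier A"
    then obtain b where b: "b \<in> carrier B" "a = r b" by (auto simp: A_def r_def carrier_FactGroup)
    hence "a [^]\<^bsub>A\<^esub> p = r (b [^]\<^bsub>B\<^esub> p)" using C.FactGroup_pow[of b p] by (simp add: A_def r_def)
    thus "a [^]\<^bsub>A\<^esub> p = \<one>\<^bsub>A\<^esub>" using r_one[of "b [^]\<^bsub>B\<^esub> p"] C(4) b(1) by simp
  next
    obtain b where b: "b \<in> carrier B" "b \<notin> C" using C(3) C.subset by blast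
    moreover obtain h where "h \<in> H" "b = q h" using b(1) by (auto simp: B_def q_def carrier_FactGroup)
    ultimately show "\<exists>h\<in>H. (r \<circ> q) h \<noteq> \<one>\<^bsub>A\<^esub>" using r_one[of b] by auto
  next
    fix h assume h: "h \<in> H"
    interpret T: cocycle G B "rcosets H" "\<lambda>C g. C #> g" "transfer_factor G q"
      by (rule transfer_cocycle[OF H B.comm_group_axioms q])
    \<comment> \<open>Composing with the projection \<open>r\<close> commutes with the transfer, and
      the values of \<open>V\<close> on \<open>H\<close> lie in \<open>J\<close>, hence in the
      kernel \<open>C\<close> of \<open>r\<close>.\<close>
    have "finprod A (\<lambda>C. r (transfer_factor G q C h)) (rcosets H) = r (V h)"
      unfolding V_def using r r_one[of "\<one>\<^bsub>B\<^esub>"] T.c_closed HG[OF h] C.one_closed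
      by (intro hom_finprod_comm_monoid[symmetric] A.comm_monoid_axioms B.comm_monoid_axioms) auto
    also have "\<dots> = \<one>\<^bsub>A\<^esub>"
      using r_one[of "V h"] C(2) h V.hom_closed[of h] by (auto simp: J_def)
    finally show "finprod A (\<lambda>C. transfer_factor G (r \<circ> q) C h) (rcosets H) = \<one>\<^bsub>A\<^esub>"
      by (simp add: transfer_factor_def)
  qed
qed

end

section \<open>The largest powerfully embedded subgroup\<close>

context group
begin

lemma conj_preimage_subgroup:
  assumes "subgroup K G" "g \<in> carrier G"
  shows "subgroup {x \<in> carrier G. g \<otimes> x \<otimes> inv g \<in> K} G"
proof (rule subgroupI)
  show "{x \<in> carrier G. g \<otimes> x \<otimes> inv g \<in> K} \<noteq> {}"
    using assms subgroup.one_closed[OF assms(1)] by (auto intro!: exI[of _ \<one>])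
next
  fix x assume x: "x \<in> {x \<in> carrier G. g \<otimes> x \<otimes> inv g \<in> K}"
  hence "inv (g \<otimes> x \<otimes> inv g) \<in> K" using subgroup.m_inv_closed[OF assms(1)] by blast
  thus "inv x \<in> {x \<in> carrier G. g \<otimes> x \<otimes> inv g \<in> K}"
    using x assms(2) by (simp add: inv_mult_group m_assoc)
next
  fix x y assume xy: "x \<in> {x \<in> carrier G. g \<otimes> x \<otimes> inv g \<in> K}" "y \<in> {x \<in> carrier G. g \<otimes> x \<otimes> inv g \<in> K}"
  hence "(g \<otimes> x \<otimes> inv g) \<otimes> (g \<otimes> y \<otimes> inv g) \<in> K" using subgroup.m_closed[OF assms(1)] by blast
  thus "x \<otimes> y \<in> {x \<in> carrier G. g \<otimes> x \<otimes> inv g \<in> K}"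
    using xy assms(2) by (simp add: m_assoc inv_cancel)
qed auto

text \<open>The elements that \<open>g\<close> conjugates into the generated subgroup form a
  subgroup, so checking generators suffices.\<close>

lemma generate_conj_closed:
  assumes "S \<subseteq> carrier G" "g \<in> carrier G" "\<And>x. x \<in> S \<Longrightarrow> g \<otimes> x \<otimes> inv g \<in> generate G S"
    and "y \<in> generate G S"
  shows "g \<otimes> y \<otimes> inv g \<in> generate G S"
proof -
  have "generate G S \<subseteq> {x \<in> carrier G. g \<otimes> x \<otimes> inv g \<in> generate G S}"
    by (rule generate_subgroup_incl[OF _ conj_preimage_subgroup[OF generate_is_subgroup[OF assms(1)] assms(2)]])
      (use assms in blast)
  thus ?thesis using assms(4) by blast
qed

lemma power_subgroup_mono:
  assumes "N \<subseteq> W" shows "power_subgroup G N k \<subseteq> power_subgroup G W k"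
  unfolding power_subgroup_def by (rule mono_generate) (use assms in blast)

lemma power_subgroup_subgroup:
  assumes "N \<subseteq> carrier G" shows "subgroup (power_subgroup G N k) G"
  unfolding power_subgroup_def by (rule generate_is_subgroup) (use assms in auto)

lemma power_subgroup_conj_closed:
  assumes "N \<subseteq> carrier G" "g \<in> carrier G" "\<And>x. x \<in> N \<Longrightarrow> g \<otimes> x \<otimes> inv g \<in> N"
    and "y \<in> power_subgroup G N k"
  shows "g \<otimes> y \<otimes> inv g \<in> power_subgroup G N k"
  unfolding power_subgroup_def
proof (rule generate_conj_closed[OF _ assms(2)])
  show "{x [^] k |x. x \<in> N} \<subseteq> carrier G" using assms(1) by auto
  show "y \<in> generate G {x [^] k |x. x \<in> N}" using assms(4) by (simp add: power_subgroup_def)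
  fix z assume "z \<in> {x [^] k |x. x \<in> N}"
  then obtain x where x: "x \<in> N" "z = x [^] k" by blast
  hence "g \<otimes> z \<otimes> inv g = (g \<otimes> x \<otimes> inv g) [^] k" using assms(1,2) by (simp add: conj_pow subset_iff)
  moreover have "(g \<otimes> x \<otimes> inv g) [^] k \<in> {x [^] k |x. x \<in> N}" using assms(3)[OF x(1)] by blast
  ultimately show "g \<otimes> z \<otimes> inv g \<in> generate G {x [^] k |x. x \<in> N}"
    using generate.incl[of _ _ G] by simp
qed

context
  fixes p :: nat and P :: "'a set"
  assumes P: "subgroup P G"
begin

lemma powerfully_embedded_subset:
  assumes "powerfully_embedded G p N P" shows "N \<subseteq> P"
  using assms normal_imp_subgroup subgroup.subset unfolding powerfully_embedded_def by force

lemma powerfully_embedded_conj_closed: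
  assumes "powerfully_embedded G p N P" "g \<in> P" "x \<in> N"
  shows "g \<otimes> x \<otimes> inv g \<in> N"
  using assms normal.inv_op_closed2[of N "G\<lparr>carrier := P\<rparr>" g x] m_inv_consistent[OF P]
  unfolding powerfully_embedded_def by simp

lemma powerfully_embedded_Union_subset:
  "\<Union> {N. powerfully_embedded G p N P} \<subseteq> P"
  using powerfully_embedded_subset by (rule Union_least) simp

lemma eta_subgroup: "subgroup (eta G p P) G"
  unfolding eta_def
  by (rule generate_is_subgroup)
    (rule subset_trans[OF powerfully_embedded_Union_subset subgroup.subset[OF P]])

lemma eta_subset: "eta G p P \<subseteq> P"
  unfolding eta_def by (rule generate_subgroup_incl[OF powerfully_embedded_Union_subset P])

lemma powerfully_embedded_subset_eta:
  assumes "powerfully_embedded G p N P" shows "N \<subseteq> eta G p P"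
proof
  fix x assume "x \<in> N"
  thus "x \<in> eta G p P" unfolding eta_def using assms by (intro generate.incl) blast
qed

lemma eta_conj_closed:
  assumes "g \<in> P" "x \<in> eta G p P" shows "g \<otimes> x \<otimes> inv g \<in> eta G p P"
  unfolding eta_def
proof (rule generate_conj_closed)
  show "\<Union> {N. powerfully_embedded G p N P} \<subseteq> carrier G"
    by (rule subset_trans[OF powerfully_embedded_Union_subset subgroup.subset[OF P]])
  show "g \<in> carrier G" using assms(1) subgroup.subset[OF P] by blast
  fix x assume "x \<in> \<Union> {N. powerfully_embedded G p N P}"
  then obtain N where N: "powerfully_embedded G p N P" "x \<in> N" by blast
  have "g \<otimes> x \<otimes> inv g \<in> \<Union> {N. powerfully_embedded G p N P}"
    using powerfully_embedded_conj_closed[OF N(1) assms(1) N(2)] N(1) by blast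
  thus "g \<otimes> x \<otimes> inv g \<in> generate G (\<Union> {N. powerfully_embedded G p N P})" by (rule generate.incl)
qed (use assms(2) in \<open>simp add: eta_def\<close>)

text \<open>For fixed \<open>u\<close>, the \<open>w\<close> whose commutator with \<open>u\<close>
  lies in \<open>?Q\<close> form a subgroup: \<open>[ab,u]\<close> is the conjugate of
  \<open>[b,u]\<close> by \<open>a\<close> times \<open>[a,u]\<close>, and \<open>?Q\<close> is
  normalized by \<open>?W\<close>. This subgroup contains every powerfully embedded
  \<open>N\<close>, because the power subgroup of \<open>N\<close> lies in
  \<open>?Q\<close>.\<close>

lemma eta_commutator:
  assumes "w \<in> eta G p P" "u \<in> P"
  shows "w \<otimes> u \<otimes> inv w \<otimes> inv u \<in> power_subgroup G (eta G p P) (if p = 2 then 4 else p)"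
proof -
  let ?W = "eta G p P" and ?q = "if p = 2 then 4 else p"
  let ?Q = "power_subgroup G ?W ?q"
  have WG: "?W \<subseteq> carrier G" by (rule subgroup.subset[OF eta_subgroup])
  have uG: "u \<in> carrier G" using assms(2) subgroup.subset[OF P] by blast
  have Q: "subgroup ?Q G" by (rule power_subgroup_subgroup[OF WG])
  have Qconj: "g \<otimes> y \<otimes> inv g \<in> ?Q" if "g \<in> ?W" "y \<in> ?Q" for g y
    using power_subgroup_conj_closed[OF WG _ _ that(2)] eta_conj_closed[of g] that(1) WG eta_subset
    by blast
  define K where "K = {w \<in> ?W. w \<otimes> u \<otimes> inv w \<otimes> inv u \<in> ?Q}"
  have "subgroup K G"
  proof (rule subgroupI)
    show "K \<subseteq> carrier G" using WG by (auto simp: K_def)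
    have "\<one> \<in> K" using subgroup.one_closed[OF eta_subgroup] subgroup.one_closed[OF Q] uG
      by (simp add: K_def)
    thus "K \<noteq> {}" by blast
  next
    fix a assume a: "a \<in> K"
    hence aW: "a \<in> ?W" "a \<in> carrier G" using WG by (auto simp: K_def)
    have ia: "inv a \<in> ?W" by (rule subgroup.m_inv_closed[OF eta_subgroup aW(1)])
    have "inv (a \<otimes> u \<otimes> inv a \<otimes> inv u) \<in> ?Q" using a subgroup.m_inv_closed[OF Q] by (auto simp: K_def)
    from Qconj[OF ia this]
    have "inv a \<otimes> inv (a \<otimes> u \<otimes> inv a \<otimes> inv u) \<otimes> inv (inv a) \<in> ?Q" .
    \<comment> \<open>The commutator \<open>[a^-1,u]\<close> is the conjugate of the inverse of
      \<open>[a,u]\<close> by \<open>a^-1\<close>.\<close>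
    also have "inv a \<otimes> inv (a \<otimes> u \<otimes> inv a \<otimes> inv u) \<otimes> inv (inv a) = inv a \<otimes> u \<otimes> inv (inv a) \<otimes> inv u"
      using aW(2) uG by (simp add: inv_mult_group m_assoc inv_cancel)
    finally show "inv a \<in> K" using ia by (simp add: K_def)
  next
    fix a b assume ab: "a \<in> K" "b \<in> K"
    hence W: "a \<in> ?W" "a \<in> carrier G" "b \<in> carrier G" using WG by (auto simp: K_def)
    have "a \<otimes> (b \<otimes> u \<otimes> inv b \<otimes> inv u) \<otimes> inv a \<in> ?Q" using Qconj[OF W(1)] ab(2) by (simp add: K_def)
    moreover have "a \<otimes> u \<otimes> inv a \<otimes> inv u \<in> ?Q" using ab(1) by (simp add: K_def)
    ultimately have "(a \<otimes> (b \<otimes> u \<otimes> inv b \<otimes> inv u) \<otimes> inv a) \<otimes> (a \<otimes> u \<otimes> inv a \<otimes> inv u) \<in> ?Q"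
      by (rule subgroup.m_closed[OF Q])
    also have "(a \<otimes> (b \<otimes> u \<otimes> inv b \<otimes> inv u) \<otimes> inv a) \<otimes> (a \<otimes> u \<otimes> inv a \<otimes> inv u)
      = a \<otimes> b \<otimes> u \<otimes> inv (a \<otimes> b) \<otimes> inv u"
      using W uG by (simp add: inv_mult_group m_assoc inv_cancel)
    finally show "a \<otimes> b \<in> K" using ab subgroup.m_closed[OF eta_subgroup] by (simp add: K_def)
  qed
  moreover have "\<Union> {N. powerfully_embedded G p N P} \<subseteq> K"
  proof
    fix x assume "x \<in> \<Union> {N. powerfully_embedded G p N P}"
    then obtain N where N: "powerfully_embedded G p N P" "x \<in> N" by blast
    have "x \<otimes> u \<otimes> inv x \<otimes> inv u \<in> commutator_subgroup G N P"
      unfolding commutator_subgroup_def by (rule generate.incl) (use N(2) assms(2) in blast)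
    also have "\<dots> \<subseteq> power_subgroup G N ?q" using N(1) unfolding powerfully_embedded_def by blast
    also have "\<dots> \<subseteq> ?Q" by (rule power_subgroup_mono[OF powerfully_embedded_subset_eta[OF N(1)]])
    finally show "x \<in> K" using powerfully_embedded_subset_eta[OF N(1)] N(2) by (auto simp: K_def)
  qed
  ultimately have "generate G (\<Union> {N. powerfully_embedded G p N P}) \<subseteq> K"
    by (intro generate_subgroup_incl)
  thus ?thesis using assms(1) unfolding eta_def[symmetric] by (auto simp: K_def)
qed

end

section \<open>Normalizers and conjugation into Sylow subgroups\<close>

lemma conj_image_eq: "g <# W #> h = (\<lambda>w. g \<otimes> w \<otimes> h) ` W"
  by (auto simp: l_coset_def r_coset_def)

lemma mem_normalizer_iff:
  assumes "W \<subseteq> carrier G"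
  shows "g \<in> normalizer G W \<longleftrightarrow> g \<in> carrier G \<and> (\<lambda>w. g \<otimes> w \<otimes> inv g) ` W = W"
  using assms unfolding normalizer_def stabilizer_def by (simp add: conj_image_eq)

lemma mem_normalizer_finite:
  assumes "finite W" "W \<subseteq> carrier G" "g \<in> carrier G" "\<And>w. w \<in> W \<Longrightarrow> g \<otimes> w \<otimes> inv g \<in> W"
  shows "g \<in> normalizer G W"
proof -
  have "inj_on (\<lambda>w. g \<otimes> w \<otimes> inv g) W"
    using assms(2,3) by (auto intro!: inj_onI simp: subset_iff)
  hence "(\<lambda>w. g \<otimes> w \<otimes> inv g) ` W = W"
    using assms by (intro endo_inj_surj) auto
  thus ?thesis using assms(2,3) by (simp add: mem_normalizer_iff)
qed

text \<open>Otherwise \<open>p * card P\<close> would divide the order of \<open>G\<close>, against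
  the multiplicity of \<open>p\<close> in it.\<close>

lemma sylow_index_coprime:
  assumes "finite (carrier G)" "Factorial_Ring.prime (p::nat)" "sylow_subgroup G p P"
    and "subgroup N G" "P \<subseteq> N"
  shows "\<not> p dvd card (rcosets\<^bsub>G\<lparr>carrier := N\<rparr>\<^esub> P)"
proof
  let ?N = "G\<lparr>carrier := N\<rparr>"
  assume "p dvd card (rcosets\<^bsub>?N\<^esub> P)"
  hence "p * card P dvd card (rcosets\<^bsub>?N\<^esub> P) * card P" by simp
  also have "card (rcosets\<^bsub>?N\<^esub> P) * card P = card N"
    using group.lagrange[OF subgroup.subgroup_is_group[OF assms(4) is_group], of P]
      subgroup_incl[OF _ assms(4,5)] assms(3) by (simp add: order_def sylow_subgroup_def)
  also have "card N dvd order G" using lagrange[OF assms(4)] by (metis dvd_triv_right)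
  finally have "p ^ Suc (multiplicity p (order G)) dvd order G"
    using assms(3) by (simp add: sylow_subgroup_def)
  moreover have "order G \<noteq> 0" using assms(1) order_gt_0_iff_finite by simp
  ultimately have "Suc (multiplicity p (order G)) \<le> multiplicity p (order G)"
    using assms(2) by (intro multiplicity_geI) (auto dest: prime_gt_1_nat)
  thus False by simp
qed

text \<open>The cyclic group generated by \<open>h\<close> is a \<open>p\<close>-subgroup of
  \<open>N\<close>, in which \<open>P\<close> has index prime to \<open>p\<close>.\<close>

lemma p_element_conj_into_sylow:
  assumes "finite (carrier G)" "Factorial_Ring.prime (p::nat)" "sylow_subgroup G p P"
    and N: "subgroup N G" "P \<subseteq> N" and h: "h \<in> N" "h [^] (p ^ n) = \<one>"
  obtains g where "g \<in> N" "g \<otimes> h \<otimes> inv g \<in> P"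
proof -
  let ?N = "G\<lparr>carrier := N\<rparr>"
  interpret N: group ?N by (rule subgroup.subgroup_is_group[OF N(1) is_group])
  have finN: "finite (carrier ?N)" using finite_subset[OF subgroup.subset[OF N(1)] assms(1)] by simp
  let ?U = "generate ?N {h}"
  have "h [^]\<^bsub>?N\<^esub> (p ^ n) = \<one>\<^bsub>?N\<^esub>" using h(2) nat_pow_consistent[of h "p ^ n" N] by simp
  hence "N.ord h dvd p ^ n" using N.pow_eq_id[of h] h(1) by simp
  then obtain m where "card ?U = p ^ m"
    using divides_primepow_nat[OF assms(2)] N.generate_pow_card[of h] h(1) by auto
  moreover have "subgroup ?U ?N" by (rule N.generate_is_subgroup) (use h(1) in simp)
  moreover have "subgroup P ?N"
    using subgroup_incl[OF _ N] assms(3) by (simp add: sylow_subgroup_def)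
  ultimately obtain g where g: "g \<in> N" "\<And>u. u \<in> ?U \<Longrightarrow> g \<otimes> u \<otimes> inv\<^bsub>?N\<^esub> g \<in> P"
    using N.p_subgroup_conj_into_index_coprime[OF finN assms(2), of ?U m P]
      sylow_index_coprime[OF assms(1-3) N] by auto
  have "h \<in> ?U" by (rule generate.incl) simp
  thus ?thesis using that[OF g(1)] g m_inv_consistent[OF N(1) g(1)] by auto
qed

end

section \<open>Control of transfer\<close>

theorem theorem1p1:
  fixes G (structure) and p :: nat and P :: "'a set"
  assumes "group G" and "finite (carrier G)" and "Factorial_Ring.prime p"
    and "sylow_subgroup G p P"
    and "weakly_closed G (eta G p P) P"
  shows "P \<inter> derived G (carrier G) = P \<inter> derived G (normalizer G (eta G p P))"
proof -
  interpret group G by fact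
  note fin = assms(2) and p = assms(3)
  have P: "subgroup P G" and cardP: "card P = p ^ multiplicity p (order G)"
    using assms(4) by (auto simp: sylow_subgroup_def)
  have PG: "P \<subseteq> carrier G" by (rule subgroup.subset[OF P])
  define W where "W = eta G p P"
  have W: "subgroup W G" and WP: "W \<subseteq> P"
    using eta_subgroup[OF P, of p] eta_subset[OF P, of p] by (simp_all add: W_def)
  have Wconj: "g \<otimes> w \<otimes> inv g \<in> W" if "g \<in> P" "w \<in> W" for g w
    using eta_conj_closed[OF P that(1)] that(2) by (simp add: W_def)
  have Wcomm: "w \<otimes> u \<otimes> inv w \<otimes> inv u \<in> power_subgroup G W (if p = 2 then 4 else p)"
    if "w \<in> W" "u \<in> P" for w u
    using eta_commutator[OF P] that by (simp add: W_def)
  have WG: "W \<subseteq> carrier G" by (rule subgroup.subset[OF W])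
  have finW: "finite W" by (rule finite_subset[OF WG fin])
  define N where "N = normalizer G W"
  have N: "subgroup N G" unfolding N_def by (rule normalizer_imp_subgroup[OF WG])
  have NG: "N \<subseteq> carrier G" by (rule subgroup.subset[OF N])
  have PN: "P \<subseteq> N"
    unfolding N_def using mem_normalizer_finite[OF finW WG] Wconj PG by blast
  note Ncl = subgroup.m_closed[OF N] subgroup.m_inv_closed[OF N] subgroup.one_closed[OF N]
  \<comment> \<open>If \<open>W\<close> fixes the coset of \<open>t\<close>, then \<open>t\<close>
    conjugates \<open>W\<close> to a \<open>p\<close>-subgroup of \<open>N\<close>, which some
    \<open>n\<close> in \<open>N\<close> conjugates further into \<open>P\<close>. Weak closure puts
    \<open>n \<otimes> t\<close> in the normalizer \<open>N\<close>, so \<open>t\<close> lies in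
    \<open>N\<close> as well.\<close>
  have no_fixed_coset: "\<exists>w \<in> W. C #> w \<noteq> C" if C: "C \<in> rcosets N" "C \<noteq> N" for C
  proof (rule ccontr)
    assume "\<not> (\<exists>w \<in> W. C #> w \<noteq> C)"
    moreover obtain t where t: "t \<in> carrier G" "C = N #> t" using C(1) unfolding RCOSETS_def by blast
    ultimately have tW: "t \<otimes> w \<otimes> inv t \<in> N" if "w \<in> W" for w
      using rcos_fixed_iff[OF N t(1), of w] that WG by blast
    interpret GN: group "G\<lparr>carrier := N\<rparr>" by (rule subgroup.subgroup_is_group[OF N is_group])
    let ?U = "(\<lambda>w. t \<otimes> w \<otimes> inv t) ` W"
    have "(\<lambda>w. t \<otimes> w \<otimes> inv t) \<in> hom G G"
      using t(1) by (auto simp: hom_def m_assoc inv_cancel)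
    then interpret c: group_hom G G "\<lambda>w. t \<otimes> w \<otimes> inv t" by unfold_locales
    have U: "subgroup ?U (G\<lparr>carrier := N\<rparr>)"
      using subgroup_incl[OF c.subgroup_img_is_subgroup[OF W] N] tW by blast
    have "inj_on (\<lambda>w. t \<otimes> w \<otimes> inv t) W"
      using WG t(1) by (auto intro!: inj_onI simp: subset_iff)
    moreover have "card W dvd card P"
    proof -
      have "card (rcosets\<^bsub>G\<lparr>carrier := P\<rparr>\<^esub> W) * card W = card P"
        using group.lagrange[OF subgroup.subgroup_is_group[OF P is_group] subgroup_incl[OF W P WP]]
        by (simp add: order_def)
      thus ?thesis by (metis dvd_triv_right)
    qed
    then obtain m where "card W = p ^ m" using cardP divides_primepow_nat[OF p] by metis
    ultimately have cardU: "card ?U = p ^ m" by (simp add: card_image)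
    have finN: "finite (carrier (G\<lparr>carrier := N\<rparr>))" using finite_subset[OF NG fin] by simp
    obtain n where n: "n \<in> N" "\<And>u. u \<in> ?U \<Longrightarrow> n \<otimes> u \<otimes> inv n \<in> P"
      using GN.p_subgroup_conj_into_index_coprime[OF finN p U cardU, of P]
        sylow_index_coprime[OF fin p assms(4) N PN] subgroup_incl[OF P N PN] m_inv_consistent[OF N]
      by auto
    have nG: "n \<in> carrier G" using n(1) NG by blast
    \<comment> \<open>Weak closure conjugates with the inverse on the left, hence the inverse of
      \<open>n \<otimes> t\<close>.\<close>
    let ?g = "inv (n \<otimes> t)"
    have eq: "inv ?g \<otimes> w \<otimes> ?g = n \<otimes> (t \<otimes> w \<otimes> inv t) \<otimes> inv n" if "w \<in> W" for w
      using that WG nG t(1) by (auto simp: m_assoc inv_mult_group)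
    have "inv ?g <# W #> ?g \<subseteq> P" unfolding conj_image_eq using eq n(2) by auto
    hence "inv ?g <# W #> ?g = W"
      using assms(5)[unfolded weakly_closed_def, rule_format, of ?g] nG t(1)
      unfolding W_def[symmetric] by blast
    hence "n \<otimes> t \<in> N"
      unfolding N_def mem_normalizer_iff[OF WG] using nG t(1) by (simp add: conj_image_eq)
    hence "inv n \<otimes> (n \<otimes> t) \<in> N" using Ncl n(1) by simp
    hence "t \<in> N" using nG t(1) by (simp add: inv_cancel)
    thus False using C(2) t(2) subgroup.rcos_const[OF N is_group] by blast
  qed
  have "x \<in> derived G N" if x: "x \<in> P" "x \<in> derived G (carrier G)" for x
  proof (rule ccontr)
    assume "x \<notin> derived G N"
    interpret GP: group "G\<lparr>carrier := P\<rparr>" by (rule subgroup.subgroup_is_group[OF P is_group])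
    have P_order: "h [^] card P = \<one>" if "h \<in> P" for h
      using GP.pow_order_eq_1[of h] that by (simp add: order_def flip: nat_pow_consistent)
    have xN: "x \<in> N" and xpow: "x [^] (p ^ multiplicity p (order G)) = \<one>"
      using x(1) PN P_order[OF x(1)] cardP by auto
    obtain A :: "'a set set monoid" and f where A: "comm_group A"
      and f: "f \<in> hom (G\<lparr>carrier := N\<rparr>) A"
      and expA: "\<And>a. a \<in> carrier A \<Longrightarrow> a [^]\<^bsub>A\<^esub> p = \<one>\<^bsub>A\<^esub>"
      and f_nontriv: "\<exists>h \<in> N. f h \<noteq> \<one>\<^bsub>A\<^esub>"
      and transfer_triv: "\<And>h. h \<in> N \<Longrightarrow> finprod A (\<lambda>C. transfer_factor G f C h) (rcosets N) = \<one>\<^bsub>A\<^esub>"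
    proof (rule exists_hom_with_trivial_transfer[OF fin p N xN x(2) \<open>x \<notin> derived G N\<close> xpow])
      fix A :: "'a set set monoid" and f
      assume "comm_group A" "f \<in> hom (G\<lparr>carrier := N\<rparr>) A" "\<And>a. a \<in> carrier A \<Longrightarrow> a [^]\<^bsub>A\<^esub> p = \<one>\<^bsub>A\<^esub>"
        "\<exists>h \<in> N. f h \<noteq> \<one>\<^bsub>A\<^esub>"
        "\<And>h. h \<in> N \<Longrightarrow> finprod A (\<lambda>C. transfer_factor G f C h) (rcosets N) = \<one>\<^bsub>A\<^esub>"
      thus thesis by (rule that)
    qed
    interpret A: comm_group A by (rule A)
    interpret GN: group "G\<lparr>carrier := N\<rparr>" by (rule subgroup.subgroup_is_group[OF N is_group])
    interpret f: group_hom "G\<lparr>carrier := N\<rparr>" A f using f by unfold_locales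
    interpret T: cocycle G A "rcosets N" "\<lambda>C g. C #> g" "transfer_factor G f"
      by (rule transfer_cocycle[OF N A f])
    have fA: "f h \<in> carrier A" if "h \<in> N" for h using f.hom_closed that by simp
    have f_mult: "f (h \<otimes> k) = f h \<otimes>\<^bsub>A\<^esub> f k" if "h \<in> N" "k \<in> N" for h k
      using f.hom_mult that by simp
    have f_inv: "f (inv h) = inv\<^bsub>A\<^esub> f h" if "h \<in> N" for h
      using f.hom_inv[of h] that m_inv_consistent[OF N that] by simp
    have f_conj: "f (g \<otimes> h \<otimes> inv g) = f h" if "g \<in> N" "h \<in> N" for g h
      using that Ncl fA by (simp add: f_mult f_inv A.m_comm[of "f g" "f h"] A.m_assoc)
    have f_pow: "f (h [^] (k::nat)) = f h [^]\<^bsub>A\<^esub> k" if "h \<in> N" for h k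
      using f.hom_nat_pow[of h k] that by (simp flip: nat_pow_consistent)
    \<comment> \<open>Conjugation in \<open>N\<close> moves a \<open>p\<close>-element into
      \<open>P\<close> and changes neither its order nor its value under \<open>f\<close>, so it can
      be compared with an element of \<open>P\<close> of least order.\<close>
    have to_P: "\<exists>h' \<in> P. f h' = f h \<and> ord h' = ord h" if h: "h \<in> N" "h [^] (p ^ n) = \<one>" for h n
    proof -
      obtain g where g: "g \<in> N" "g \<otimes> h \<otimes> inv g \<in> P"
        using p_element_conj_into_sylow[OF fin p assms(4) N PN h] .
      have gG: "g \<in> carrier G" "h \<in> carrier G" using g(1) h(1) NG by auto
      have "(g \<otimes> h \<otimes> inv g) [^] k = \<one> \<longleftrightarrow> h [^] k = \<one>" for k :: nat
      proof -
        have "(g \<otimes> h \<otimes> inv g) [^] k = g \<otimes> h [^] k \<otimes> inv g" using conj_pow gG by simp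
        moreover have "g \<otimes> h [^] k \<otimes> inv g = \<one> \<longleftrightarrow> h [^] k = \<one>"
        proof
          assume *: "g \<otimes> h [^] k \<otimes> inv g = \<one>"
          have "h [^] k = inv g \<otimes> (g \<otimes> h [^] k \<otimes> inv g) \<otimes> g"
            using gG by (simp add: m_assoc inv_cancel)
          thus "h [^] k = \<one>" using gG unfolding * by simp
        qed (use gG in simp)
        ultimately show ?thesis by simp
      qed
      hence "ord (g \<otimes> h \<otimes> inv g) = ord h"
        using gG by (intro ord_unique[THEN iffD2]) (auto simp: pow_eq_id)
      thus ?thesis using g f_conj h(1) by blast
    qed
    \<comment> \<open>Raising \<open>h\<close> to the \<open>p'\<close>-part \<open>m\<close> of the
      group order gives a \<open>p\<close>-element, and \<open>f\<close> stays nontrivial on it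
      because \<open>f h\<close> has order \<open>p\<close>, which is prime to
      \<open>m\<close>.\<close>
    have "\<exists>h \<in> P. f h \<noteq> \<one>\<^bsub>A\<^esub>"
    proof -
      obtain h where h: "h \<in> N" "f h \<noteq> \<one>\<^bsub>A\<^esub>" using f_nontriv by blast
      have hG: "h \<in> carrier G" using h(1) NG by blast
      have "order G \<noteq> 0" using fin order_gt_0_iff_finite by simp
      then obtain m where m: "order G = p ^ multiplicity p (order G) * m" "\<not> p dvd m"
        using multiplicity_decompose'[of "order G" p] not_prime_unit[of p] p by metis
      have hm: "h [^] m \<in> N" using h(1) by (induction m) (auto intro: Ncl)
      have "(h [^] m) [^] (p ^ multiplicity p (order G)) = \<one>"
        using pow_order_eq_1[OF hG] m(1) hG by (simp add: nat_pow_pow mult.commute)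
      moreover have "f (h [^] m) \<noteq> \<one>\<^bsub>A\<^esub>"
      proof
        assume "f (h [^] m) = \<one>\<^bsub>A\<^esub>"
        hence "A.ord (f h) dvd m" using f_pow[OF h(1)] A.pow_eq_id[OF fA[OF h(1)]] by simp
        moreover have "A.ord (f h) dvd p" using expA[OF fA[OF h(1)]] A.pow_eq_id[OF fA[OF h(1)]] by simp
        ultimately have "A.ord (f h) = 1" using m(2) p by (metis prime_nat_iff)
        thus False using A.ord_eq_1[OF fA[OF h(1)]] h(2) by simp
      qed
      ultimately show ?thesis using to_P[OF hm] by metis
    qed
    then obtain u where u: "u \<in> P" "f u \<noteq> \<one>\<^bsub>A\<^esub>"
      and min: "\<And>h. \<lbrakk>h \<in> P; f h \<noteq> \<one>\<^bsub>A\<^esub>\<rbrakk> \<Longrightarrow> ord u \<le> ord h"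
      using exists_least_iff[of "\<lambda>k. \<exists>h \<in> P. f h \<noteq> \<one>\<^bsub>A\<^esub> \<and> ord h = k"] by (metis not_le)
    have uG: "u \<in> carrier G" and uN: "u \<in> N" using u(1) PG PN by auto
    have ord_u: "ord u dvd p ^ multiplicity p (order G)" "ord u \<noteq> 1"
      using P_order[OF u(1)] pow_eq_id[OF uG] cardP ord_eq_1[OF uG] u(2) f.hom_one by auto
    then obtain a where a: "ord u = p ^ Suc a"
      using divides_primepow_nat[OF p] by (metis not0_implies_Suc power_0)
    \<comment> \<open>At a fixed coset the factor is \<open>f\<close> of a conjugate of
      \<open>u [^] (p * k)\<close>. The order of this conjugate is at most \<open>p ^ a\<close>,
      less than the order \<open>p ^ Suc a\<close> of \<open>u\<close>, so minimality of
      \<open>u\<close> makes the value trivial.\<close>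
    have low: "transfer_factor G f C (u [^] (p * k)) = \<one>\<^bsub>A\<^esub>"
      if C: "C \<in> rcosets N" "C #> u [^] (p * k) = C" for C k
    proof -
      let ?r = "coset_rep C" and ?v = "u [^] (p * k)"
      have r: "?r \<in> carrier G" by (rule coset_rep_in(2)[OF N C(1)])
      have v: "?r \<otimes> ?v \<otimes> inv ?r \<in> N"
        using coset_rep_conj_in[OF N C(1), of ?v] C(2) uG by simp
      have "?v [^] (p ^ a) = (u [^] ord u) [^] k" using uG by (simp add: nat_pow_pow a mult_ac del: pow_ord_eq_1)
      hence "?v [^] (p ^ a) = \<one>" using uG by simp
      hence va: "(?r \<otimes> ?v \<otimes> inv ?r) [^] (p ^ a) = \<one>" using conj_pow[OF r, of ?v] uG r by simp
      hence "ord (?r \<otimes> ?v \<otimes> inv ?r) dvd p ^ a" using pow_eq_id v NG by blast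
      hence "ord (?r \<otimes> ?v \<otimes> inv ?r) \<le> p ^ a" using p by (auto intro!: dvd_imp_le dest: prime_gt_0_nat)
      moreover have "p ^ a < ord u" using prime_gt_1_nat[OF p] by (simp add: a)
      ultimately have "f (?r \<otimes> ?v \<otimes> inv ?r) = \<one>\<^bsub>A\<^esub>" using to_P[OF v va] min by fastforce
      thus ?thesis using C(2) by (simp add: transfer_factor_def)
    qed
    let ?S = "rcosets N - {N}"
    have finR: "finite (rcosets N)" using fin rcosets_part_G[OF N] finite_UnionD by metis
    have NR: "N \<in> rcosets N" by (rule subgroup.subgroup_in_rcosets[OF N is_group])
    have N_act: "N #> g = N" if "g \<in> N" for g using subgroup.rcos_const[OF N is_group that] .
    have "T.set_cocycle ?S u = \<one>\<^bsub>A\<^esub>"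
    proof (rule T.set_cocycle_no_fixed_points_trivial[OF fin p P cardP W WP Wconj Wcomm expA])
      fix C g assume C: "C \<in> ?S" and g: "g \<in> P"
      \<comment> \<open>The coset \<open>N\<close> is fixed by \<open>P\<close>, so injectivity of
        the action keeps the other cosets away from it.\<close>
      have "C #> g \<noteq> N"
      proof
        assume "C #> g = N"
        moreover have "N #> g = N" using N_act g PN by blast
        ultimately show False
          using inj_onD[OF T.inj_on_act[of g], of C N] C NR g PG by auto
      qed
      thus "C #> g \<in> ?S" using rcosets_act_closed[OF N] C g PG by blast
    next
      fix C assume "C \<in> ?S"
      thus "\<exists>w\<in>W. C #> w \<noteq> C" using no_fixed_coset by blast
    qed (use finR u(1) low in auto)
    \<comment> \<open>The representative of the coset \<open>N\<close> only conjugates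
      \<open>u\<close> within \<open>N\<close>, and \<open>f\<close> is constant on
      conjugates.\<close>
    moreover have "transfer_factor G f N u = f u"
    proof -
      have "coset_rep N \<in> N" by (rule coset_rep_in(1)[OF N NR])
      thus ?thesis using f_conj uN N_act[OF uN] by (simp add: transfer_factor_def)
    qed
    \<comment> \<open>Splitting off the coset \<open>N\<close> leaves \<open>f u\<close> times a
      trivial product, while the whole transfer vanishes at \<open>u\<close>.\<close>
    moreover have "finprod A (\<lambda>C. transfer_factor G f C u) (insert N ?S) =
      transfer_factor G f N u \<otimes>\<^bsub>A\<^esub> finprod A (\<lambda>C. transfer_factor G f C u) ?S"
      by (rule A.finprod_insert) (use finR NR uG T.c_closed in auto)
    moreover have "insert N ?S = rcosets N" using NR by blast
    ultimately have "f u = \<one>\<^bsub>A\<^esub>"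
      using transfer_triv[OF uN] fA[OF uN] unfolding T.set_cocycle_def by simp
    thus False using u(2) by simp
  qed
  moreover have "derived G N \<subseteq> derived G (carrier G)" by (rule mono_derived[OF NG])
  ultimately show ?thesis unfolding N_def W_def by blast
qed

end
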